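(* Let $G$ and $H$ be (discrete) groups which are both $\omega$-saturated as structures in the language of pure groups. If $G\equiv H$ in the language of pure groups, then $(\ell^{1}(G),* )\equiv(\ell^{1}(H),* )$ as $\mathcal{L}_{\mathrm{cnv}}$-structures.
   Context: For a discrete group $G$, $(\ell^1(G),* )$ denotes the convolution algebra of $G$: the real Banach lattice $\ell^1(G)$ (functions $f:G\to\mathbb{R}$ with $\|f\|=\sum_{x}|f(x)|<\infty$, pointwise order) equipped with convolution $(f*g)(x)=\sum_{y\in G}f(y)g(y^{-1}x)$. It is regarded as a metric structure in continuous first-order logic in the language $\mathcal{L}_{\mathrm{cnv}}=\{+,0,\wedge,\vee,\|\cdot\|,*\}$ with metric $d(f,g)=\|f-g\|$; formally one works in the unit ball, treating $+,\wedge,\vee$ as maps from the unit ball to the ball of radius $2$ (or rescaling them by $1/2$). $\equiv$ between convolution algebras is elementary equivalence in continuous logic. The language of pure groups is $\mathcal{L}_{\mathrm{grp}}=\{\cdot\}$; elementary equivalence and $\omega$-saturation of groups (every complete type over a finite parameter set is realized) are in the sense of classical first-order logic. *)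

theory Defs
  imports "HOL-Algebra.Group" "HOL-Analysis.Infinite_Sum" "HOL-Analysis.Function_Topology"
begin

section \<open>Classical first-order logic in the language of pure groups\<close>

datatype grp_tm = GVar nat | GMul grp_tm grp_tm

datatype grp_fm =
    GEq grp_tm grp_tm
  | GNeg grp_fm
  | GAnd grp_fm grp_fm
  | GEx nat grp_fm

primrec grp_tm_vars :: "grp_tm \<Rightarrow> nat set" where
  "grp_tm_vars (GVar i) = {i}"
| "grp_tm_vars (GMul s t) = grp_tm_vars s \<union> grp_tm_vars t"

primrec grp_fv :: "grp_fm \<Rightarrow> nat set" where
  "grp_fv (GEq s t) = grp_tm_vars s \<union> grp_tm_vars t"
| "grp_fv (GNeg \<phi>) = grp_fv \<phi>"
| "grp_fv (GAnd \<phi> \<psi>) = grp_fv \<phi> \<union> grp_fv \<psi>"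
| "grp_fv (GEx i \<phi>) = grp_fv \<phi> - {i}"

primrec grp_eval :: "('a, 'm) monoid_scheme \<Rightarrow> (nat \<Rightarrow> 'a) \<Rightarrow> grp_tm \<Rightarrow> 'a" where
  "grp_eval G v (GVar i) = v i"
| "grp_eval G v (GMul s t) = grp_eval G v s \<otimes>\<^bsub>G\<^esub> grp_eval G v t"

primrec grp_sat :: "('a, 'm) monoid_scheme \<Rightarrow> (nat \<Rightarrow> 'a) \<Rightarrow> grp_fm \<Rightarrow> bool" where
  "grp_sat G v (GEq s t) \<longleftrightarrow> grp_eval G v s = grp_eval G v t"
| "grp_sat G v (GNeg \<phi>) \<longleftrightarrow> \<not> grp_sat G v \<phi>"
| "grp_sat G v (GAnd \<phi> \<psi>) \<longleftrightarrow> grp_sat G v \<phi> \<and> grp_sat G v \<psi>"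
| "grp_sat G v (GEx i \<phi>) \<longleftrightarrow> (\<exists>a\<in>carrier G. grp_sat G (v(i := a)) \<phi>)"

definition grp_models :: "('a, 'm) monoid_scheme \<Rightarrow> grp_fm \<Rightarrow> bool" where
  "grp_models G \<phi> \<longleftrightarrow> (\<forall>v. range v \<subseteq> carrier G \<longrightarrow> grp_sat G v \<phi>)"

definition grp_elem_equiv ::
    "('a, 'm) monoid_scheme \<Rightarrow> ('b, 'n) monoid_scheme \<Rightarrow> bool" where
  "grp_elem_equiv G H \<longleftrightarrow>
     (\<forall>\<phi>. grp_fv \<phi> = {} \<longrightarrow> (grp_models G \<phi> \<longleftrightarrow> grp_models H \<phi>))"

text \<open>
  A finite parameter set is given by a list \<open>as\<close> enumerating it.  A formula over it with free
  variables among \<open>x\<^sub>0, \<dots>, x\<^sub>n\<^sub>-\<^sub>1\<close> is then a formula of the pure language in the variables with index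
  below \<open>n + length as\<close>, where the variables from index \<open>n\<close> on stand for the parameters.
  For variables in that range, the assignment \<open>(!) (xs @ as)\<close> is the intended one; its values
  elsewhere are irrelevant.
\<close>

definition grp_fm_over :: "nat \<Rightarrow> 'a list \<Rightarrow> grp_fm set" where
  "grp_fm_over n as = {\<phi>. grp_fv \<phi> \<subseteq> {..<n + length as}}"

definition grp_realizes ::
    "('a, 'm) monoid_scheme \<Rightarrow> 'a list \<Rightarrow> 'a list \<Rightarrow> grp_fm set \<Rightarrow> bool" where
  "grp_realizes G as xs p \<longleftrightarrow> (\<forall>\<phi>\<in>p. grp_sat G ((!) (xs @ as)) \<phi>)"

definition grp_complete_type ::
    "('a, 'm) monoid_scheme \<Rightarrow> nat \<Rightarrow> 'a list \<Rightarrow> grp_fm set \<Rightarrow> bool" where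
  "grp_complete_type G n as p \<longleftrightarrow>
     p \<subseteq> grp_fm_over n as \<and>
     (\<forall>q\<subseteq>p. finite q \<longrightarrow>
        (\<exists>xs. length xs = n \<and> set xs \<subseteq> carrier G \<and> grp_realizes G as xs q)) \<and>
     (\<forall>\<phi>\<in>grp_fm_over n as. \<phi> \<in> p \<or> GNeg \<phi> \<in> p)"

definition grp_omega_saturated :: "('a, 'm) monoid_scheme \<Rightarrow> bool" where
  "grp_omega_saturated G \<longleftrightarrow>
     (\<forall>n as p. set as \<subseteq> carrier G \<longrightarrow> grp_complete_type G n as p \<longrightarrow>
        (\<exists>xs. length xs = n \<and> set xs \<subseteq> carrier G \<and> grp_realizes G as xs p))"


section \<open>The convolution algebra of a discrete group\<close>

text \<open>
  Elements of \<open>\<ell>\<^sup>1(G)\<close> are represented by functions on the whole type that vanish outside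
  the carrier of \<open>G\<close>.
\<close>

definition l1 :: "('a, 'm) monoid_scheme \<Rightarrow> ('a \<Rightarrow> real) set" where
  "l1 G = {f. (\<forall>x. x \<notin> carrier G \<longrightarrow> f x = 0) \<and> f abs_summable_on carrier G}"

definition l1_norm :: "('a, 'm) monoid_scheme \<Rightarrow> ('a \<Rightarrow> real) \<Rightarrow> real" where
  "l1_norm G f = (\<Sum>\<^sub>\<infinity>x\<in>carrier G. \<bar>f x\<bar>)"

definition l1_ball :: "('a, 'm) monoid_scheme \<Rightarrow> ('a \<Rightarrow> real) set" where
  "l1_ball G = {f \<in> l1 G. l1_norm G f \<le> 1}"

definition conv ::
    "('a, 'm) monoid_scheme \<Rightarrow> ('a \<Rightarrow> real) \<Rightarrow> ('a \<Rightarrow> real) \<Rightarrow> 'a \<Rightarrow> real" where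
  "conv G f g x =
     (if x \<in> carrier G
      then (\<Sum>\<^sub>\<infinity>y\<in>carrier G. f y * g (inv\<^bsub>G\<^esub> y \<otimes>\<^bsub>G\<^esub> x)) else 0)"


section \<open>Continuous first-order logic in the language of convolution algebras\<close>

text \<open>
  The only sort is the unit ball.  Addition and the two lattice operations are rescaled by
  \<open>1/2\<close>, so that they map the unit ball to itself.

  In \<open>CConn u \<phi>s\<close> the connective is \<open>u\<close> restricted to its first \<open>length \<phi>s\<close> arguments, the others
  being set to 0.  With \<open>u\<close> continuous for the product topology, these are exactly the continuous
  functions \<open>\<real>\<^sup>n \<rightarrow> \<real>\<close> for \<open>n = length \<phi>s\<close>.
\<close>

datatype cnv_tm =
    CVar nat
  | CZero
  | CPlus cnv_tm cnv_tm
  | CMeet cnv_tm cnv_tm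
  | CJoin cnv_tm cnv_tm
  | CConv cnv_tm cnv_tm

datatype cnv_fm =
    CDist cnv_tm cnv_tm
  | CNorm cnv_tm
  | CConn "(nat \<Rightarrow> real) \<Rightarrow> real" "cnv_fm list"
  | CSup nat cnv_fm
  | CInf nat cnv_fm

primrec cnv_tm_vars :: "cnv_tm \<Rightarrow> nat set" where
  "cnv_tm_vars (CVar i) = {i}"
| "cnv_tm_vars CZero = {}"
| "cnv_tm_vars (CPlus s t) = cnv_tm_vars s \<union> cnv_tm_vars t"
| "cnv_tm_vars (CMeet s t) = cnv_tm_vars s \<union> cnv_tm_vars t"
| "cnv_tm_vars (CJoin s t) = cnv_tm_vars s \<union> cnv_tm_vars t"
| "cnv_tm_vars (CConv s t) = cnv_tm_vars s \<union> cnv_tm_vars t"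

fun cnv_fv :: "cnv_fm \<Rightarrow> nat set" where
  "cnv_fv (CDist s t) = cnv_tm_vars s \<union> cnv_tm_vars t"
| "cnv_fv (CNorm t) = cnv_tm_vars t"
| "cnv_fv (CConn u \<phi>s) = (\<Union>\<phi>\<in>set \<phi>s. cnv_fv \<phi>)"
| "cnv_fv (CSup i \<phi>) = cnv_fv \<phi> - {i}"
| "cnv_fv (CInf i \<phi>) = cnv_fv \<phi> - {i}"

fun cnv_wf :: "cnv_fm \<Rightarrow> bool" where
  "cnv_wf (CDist s t) \<longleftrightarrow> True"
| "cnv_wf (CNorm t) \<longleftrightarrow> True"
| "cnv_wf (CConn u \<phi>s) \<longleftrightarrow> continuous_on UNIV u \<and> (\<forall>\<phi>\<in>set \<phi>s. cnv_wf \<phi>)"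
| "cnv_wf (CSup i \<phi>) \<longleftrightarrow> cnv_wf \<phi>"
| "cnv_wf (CInf i \<phi>) \<longleftrightarrow> cnv_wf \<phi>"

primrec cnv_eval ::
    "('a, 'm) monoid_scheme \<Rightarrow> (nat \<Rightarrow> 'a \<Rightarrow> real) \<Rightarrow> cnv_tm \<Rightarrow> 'a \<Rightarrow> real" where
  "cnv_eval G v (CVar i) = v i"
| "cnv_eval G v CZero = (\<lambda>x. 0)"
| "cnv_eval G v (CPlus s t) = (\<lambda>x. (cnv_eval G v s x + cnv_eval G v t x) / 2)"
| "cnv_eval G v (CMeet s t) = (\<lambda>x. min (cnv_eval G v s x) (cnv_eval G v t x) / 2)"
| "cnv_eval G v (CJoin s t) = (\<lambda>x. max (cnv_eval G v s x) (cnv_eval G v t x) / 2)"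
| "cnv_eval G v (CConv s t) = conv G (cnv_eval G v s) (cnv_eval G v t)"

fun cnv_val ::
    "('a, 'm) monoid_scheme \<Rightarrow> (nat \<Rightarrow> 'a \<Rightarrow> real) \<Rightarrow> cnv_fm \<Rightarrow> real" where
  "cnv_val G v (CDist s t) = l1_norm G (\<lambda>x. cnv_eval G v s x - cnv_eval G v t x)"
| "cnv_val G v (CNorm t) = l1_norm G (cnv_eval G v t)"
| "cnv_val G v (CConn u \<phi>s) =
     u (\<lambda>i. if i < length \<phi>s then map (cnv_val G v) \<phi>s ! i else 0)"
| "cnv_val G v (CSup i \<phi>) = (SUP f\<in>l1_ball G. cnv_val G (v(i := f)) \<phi>)"
| "cnv_val G v (CInf i \<phi>) = (INF f\<in>l1_ball G. cnv_val G (v(i := f)) \<phi>)"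

text \<open>The value of a sentence does not depend on the assignment, so the zero one is used.\<close>

definition cnv_elem_equiv ::
    "('a, 'm) monoid_scheme \<Rightarrow> ('b, 'n) monoid_scheme \<Rightarrow> bool" where
  "cnv_elem_equiv G H \<longleftrightarrow>
     (\<forall>\<phi>. cnv_wf \<phi> \<longrightarrow> cnv_fv \<phi> = {} \<longrightarrow>
        cnv_val G (\<lambda>_ _. 0) \<phi> = cnv_val H (\<lambda>_ _. 0) \<phi>)"

end

theory Submission
  imports Defs "HOL-Analysis.Function_Metric"
begin

text \<open>
  By saturation, the pairs of finite tuples of \<open>G\<close> and \<open>H\<close> with the same type form a back-and-forth
  system \<open>P\<close>, which contains the pair of empty tuples because \<open>G \<equiv> H\<close>.  Say that \<open>f \<in> \<ell>\<^sup>1(G)\<close> and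
  \<open>g \<in> \<ell>\<^sup>1(H)\<close> match along \<open>p \<in> P\<close> if they are supported on the domain and on the range of \<open>p\<close> and
  \<open>p\<close> carries \<open>f\<close> to \<open>g\<close>.  Matching is preserved by the lattice operations, and by convolution
  once \<open>p\<close> is extended to the products of the elements of its domain.  Hence formulas take the same
  value at matching assignments: at a quantifier, finitely supported functions are dense in the unit
  ball and formulas are uniformly continuous, so it suffices to extend \<open>p\<close> to one further finite
  support, up to an arbitrarily small error.
\<close>

section \<open>A back-and-forth system from saturation\<close>

primrec grp_tm_rename :: "(nat \<Rightarrow> nat) \<Rightarrow> grp_tm \<Rightarrow> grp_tm" where
  "grp_tm_rename r (GVar i) = GVar (r i)"
| "grp_tm_rename r (GMul s t) = GMul (grp_tm_rename r s) (grp_tm_rename r t)"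

text \<open>Bound variables are renamed as well, so that an injective renaming cannot cause capture.\<close>

primrec grp_rename :: "(nat \<Rightarrow> nat) \<Rightarrow> grp_fm \<Rightarrow> grp_fm" where
  "grp_rename r (GEq s t) = GEq (grp_tm_rename r s) (grp_tm_rename r t)"
| "grp_rename r (GNeg \<phi>) = GNeg (grp_rename r \<phi>)"
| "grp_rename r (GAnd \<phi> \<psi>) = GAnd (grp_rename r \<phi>) (grp_rename r \<psi>)"
| "grp_rename r (GEx i \<phi>) = GEx (r i) (grp_rename r \<phi>)"

lemma grp_eval_rename: "grp_eval G v (grp_tm_rename r t) = grp_eval G (v \<circ> r) t"
  by (induction t) auto

lemma grp_sat_rename:
  assumes "inj r"
  shows "grp_sat G v (grp_rename r \<phi>) \<longleftrightarrow> grp_sat G (v \<circ> r) \<phi>"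
proof (induction \<phi> arbitrary: v)
  case (GEx i \<phi>)
  \<comment> \<open>The only use of injectivity: the update at \<open>r i\<close> must be seen by
    \<open>v \<circ> r\<close> at \<open>i\<close> and nowhere else.\<close>
  have "v(r i := a) \<circ> r = (v \<circ> r)(i := a)" for a
    using assms by (auto simp: fun_eq_iff inj_def)
  then show ?case
    by (simp only: grp_rename.simps grp_sat.simps GEx)
qed (simp_all add: grp_eval_rename comp_def)

lemma grp_tm_vars_rename: "grp_tm_vars (grp_tm_rename r t) = r ` grp_tm_vars t"
  by (induction t) auto

lemma grp_fv_rename:
  assumes "inj r"
  shows "grp_fv (grp_rename r \<phi>) = r ` grp_fv \<phi>"
  by (induction \<phi>) (auto simp: grp_tm_vars_rename image_Un image_set_diff[OF assms])

lemma grp_eval_cong: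
  "(\<And>i. i \<in> grp_tm_vars t \<Longrightarrow> v i = w i) \<Longrightarrow> grp_eval G v t = grp_eval G w t"
  by (induction t) auto

lemma grp_sat_cong:
  "(\<And>i. i \<in> grp_fv \<phi> \<Longrightarrow> v i = w i) \<Longrightarrow> grp_sat G v \<phi> \<longleftrightarrow> grp_sat G w \<phi>"
proof (induction \<phi> arbitrary: v w)
  case (GEq s t)
  then show ?case
    using grp_eval_cong[of s v w G] grp_eval_cong[of t v w G] by auto
next
  case (GNeg \<phi>)
  have "grp_sat G v \<phi> \<longleftrightarrow> grp_sat G w \<phi>"
    by (rule GNeg.IH) (use GNeg.prems in simp)
  then show ?case
    by simp
next
  case (GAnd \<phi> \<psi>)
  have "grp_sat G v \<phi> \<longleftrightarrow> grp_sat G w \<phi>" "grp_sat G v \<psi> \<longleftrightarrow> grp_sat G w \<psi>"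
    by (rule GAnd.IH, use GAnd.prems in simp)+
  then show ?case
    by simp
next
  case (GEx i \<phi>)
  have "grp_sat G (v(i := a)) \<phi> \<longleftrightarrow> grp_sat G (w(i := a)) \<phi>" for a
    by (rule GEx.IH) (use GEx.prems in auto)
  then show ?case
    by simp
qed

text \<open>The language has no constant for truth, so the empty conjunction is a trivial equation.
  This makes variable 0 always free, which is harmless below, where 0 stands for the new
  element.\<close>

primrec grp_conj :: "grp_fm list \<Rightarrow> grp_fm" where
  "grp_conj [] = GEq (GVar 0) (GVar 0)"
| "grp_conj (\<phi> # \<phi>s) = GAnd \<phi> (grp_conj \<phi>s)"

lemma grp_sat_conj: "grp_sat G v (grp_conj \<phi>s) \<longleftrightarrow> (\<forall>\<phi>\<in>set \<phi>s. grp_sat G v \<phi>)"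
  by (induction \<phi>s) auto

lemma grp_fv_conj: "grp_fv (grp_conj \<phi>s) = insert 0 (\<Union>\<phi>\<in>set \<phi>s. grp_fv \<phi>)"
  by (induction \<phi>s) auto

section \<open>Tuples with the same complete type\<close>

definition grp_same_type ::
    "('a, 'm) monoid_scheme \<Rightarrow> ('b, 'n) monoid_scheme \<Rightarrow> 'a list \<Rightarrow> 'b list \<Rightarrow> bool" where
  "grp_same_type G H as bs \<longleftrightarrow>
     length as = length bs \<and> set as \<subseteq> carrier G \<and> set bs \<subseteq> carrier H \<and>
     (\<forall>\<phi>. grp_fv \<phi> \<subseteq> {..<length as} \<longrightarrow>
        (grp_sat G ((!) as) \<phi> \<longleftrightarrow> grp_sat H ((!) bs) \<phi>))"

lemma grp_same_type_sym: "grp_same_type G H as bs \<Longrightarrow> grp_same_type H G bs as"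
  unfolding grp_same_type_def by metis

text \<open>A nonempty carrier supplies at least one of the assignments over which
  \<open>grp_models\<close> quantifies. By coincidence the truth value there is the one at any
  \<open>v\<close>, even if \<open>v\<close> leaves the carrier as \<open>(!) []\<close> may
  do.\<close>

lemma grp_models_sentence:
  assumes "grp_fv \<phi> = {}" and "carrier G \<noteq> {}"
  shows "grp_models G \<phi> \<longleftrightarrow> grp_sat G v \<phi>"
proof -
  obtain a where "a \<in> carrier G"
    using assms(2) by auto
  then have "range (\<lambda>_::nat. a) \<subseteq> carrier G"
    by auto
  moreover have "grp_sat G w \<phi> \<longleftrightarrow> grp_sat G v \<phi>" for w
    by (rule grp_sat_cong) (simp add: assms(1))
  ultimately show ?thesis
    unfolding grp_models_def by blast
qed

text \<open>Formulas over the empty tuple are exactly the sentences. This is where elementary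
  equivalence enters.\<close>

lemma grp_same_type_Nil:
  assumes "group G" and "group H" and "grp_elem_equiv G H"
  shows "grp_same_type G H [] []"
proof -
  have "carrier G \<noteq> {}" "carrier H \<noteq> {}"
    using assms(1,2) group.is_monoid monoid.one_closed by blast+
  then have "grp_sat G ((!) []) \<phi> \<longleftrightarrow> grp_sat H ((!) []) \<phi>" if "grp_fv \<phi> = {}" for \<phi>
    using that assms(3) grp_models_sentence[OF that, of G "(!) []"]
      grp_models_sentence[OF that, of H "(!) []"] by (simp add: grp_elem_equiv_def)
  then show ?thesis
    by (simp add: grp_same_type_def)
qed

text \<open>
  Prepending an element shifts all variables by one.  This cyclic permutation undoes the shift
  on the parameters and moves the new variable out of the way.
\<close>

definition unshift :: "nat \<Rightarrow> nat \<Rightarrow> nat" where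
  "unshift m i = (if i = 0 then m else if i \<le> m then i - 1 else i)"

lemma inj_unshift: "inj (unshift m)"
  unfolding inj_def unshift_def by presburger

lemma grp_sat_unshift:
  assumes "grp_fv \<psi> \<subseteq> {..<Suc (length cs)}"
  shows "grp_sat K (((!) cs)(length cs := c)) (grp_rename (unshift (length cs)) \<psi>)
    \<longleftrightarrow> grp_sat K ((!) (c # cs)) \<psi>"
  unfolding grp_sat_rename[OF inj_unshift]
proof (rule grp_sat_cong)
  fix i assume "i \<in> grp_fv \<psi>"
  then have "i \<le> length cs"
    using assms by auto
  then show "(((!) cs)(length cs := c) \<circ> unshift (length cs)) i = (c # cs) ! i"
    by (cases i) (auto simp: unshift_def)
qed

text \<open>Quantifying the new element away leaves a formula about the old tuple, and such formulas
  transfer from \<open>as\<close> to \<open>bs\<close>.\<close>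

lemma grp_same_type_Ex:
  assumes "grp_same_type G H as bs" and "a \<in> carrier G"
    and fv: "grp_fv \<psi> \<subseteq> {..<Suc (length as)}" and sat: "grp_sat G ((!) (a # as)) \<psi>"
  shows "\<exists>b\<in>carrier H. grp_sat H ((!) (b # bs)) \<psi>"
proof -
  have len: "length bs = length as"
    using assms(1) by (simp add: grp_same_type_def)
  \<comment> \<open>The new element moves from index 0 to \<open>length as\<close>, where it is
    bound; the parameters return to their indices in \<open>as\<close>, so they alone remain
    free.\<close>
  let ?\<theta> = "GEx (length as) (grp_rename (unshift (length as)) \<psi>)"
  have "unshift (length as) i < length as"
    if "i < Suc (length as)" "unshift (length as) i \<noteq> length as" for i
    using that by (auto simp: unshift_def split: if_splits)
  then have "grp_fv ?\<theta> \<subseteq> {..<length as}"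
    using fv by (auto simp: grp_fv_rename[OF inj_unshift])
  then have "grp_sat G ((!) as) ?\<theta> \<longleftrightarrow> grp_sat H ((!) bs) ?\<theta>"
    using assms(1) unfolding grp_same_type_def by blast
  moreover have "grp_sat G ((!) as) ?\<theta>"
    using grp_sat_unshift[OF fv] sat assms(2) by auto
  ultimately show ?thesis
    using grp_sat_unshift[of \<psi> bs H] fv by (auto simp: len)
qed

text \<open>The type of \<open>a\<close> over \<open>as\<close>, read over \<open>bs\<close>, is
  finitely satisfiable in \<open>H\<close> because finite conjunctions transfer by
  \<open>grp_same_type_Ex\<close>. Saturation of \<open>H\<close> then realizes it.\<close>

lemma grp_same_type_forth:
  assumes type: "grp_same_type G H as bs" and sat: "grp_omega_saturated H" and a: "a \<in> carrier G"
  shows "\<exists>b\<in>carrier H. grp_same_type G H (a # as) (b # bs)"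
proof -
  have len: "length bs = length as" and as: "set as \<subseteq> carrier G" and bs: "set bs \<subseteq> carrier H"
    using type by (simp_all add: grp_same_type_def)
  define p where
    "p = {\<phi>. grp_fv \<phi> \<subseteq> {..<Suc (length as)} \<and> grp_sat G ((!) (a # as)) \<phi>}"
  have "\<exists>xs. length xs = 1 \<and> set xs \<subseteq> carrier H \<and> grp_realizes H bs xs q"
    if "q \<subseteq> p" "finite q" for q
  proof -
    obtain \<phi>s where \<phi>s: "q = set \<phi>s"
      using \<open>finite q\<close> finite_list by blast
    have "grp_fv (grp_conj \<phi>s) \<subseteq> {..<Suc (length as)}"
      using that(1) by (auto simp: grp_fv_conj \<phi>s p_def)
    moreover have "grp_sat G ((!) (a # as)) (grp_conj \<phi>s)"
      using that(1) by (auto simp: grp_sat_conj \<phi>s p_def)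
    ultimately obtain b where "b \<in> carrier H" "grp_sat H ((!) (b # bs)) (grp_conj \<phi>s)"
      using grp_same_type_Ex[OF type a] by blast
    then have "length [b] = 1 \<and> set [b] \<subseteq> carrier H \<and> grp_realizes H bs [b] q"
      by (auto simp: grp_realizes_def grp_sat_conj \<phi>s)
    then show ?thesis by blast
  qed
  moreover have "\<phi> \<in> p \<or> GNeg \<phi> \<in> p" if "\<phi> \<in> grp_fm_over 1 bs" for \<phi>
    using that by (auto simp: grp_fm_over_def p_def len)
  moreover have "p \<subseteq> grp_fm_over 1 bs"
    by (auto simp: grp_fm_over_def p_def len)
  ultimately have "grp_complete_type H 1 bs p"
    unfolding grp_complete_type_def by blast
  then obtain xs where xs: "length xs = 1" "set xs \<subseteq> carrier H" "grp_realizes H bs xs p"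
    using sat bs unfolding grp_omega_saturated_def by blast
  then obtain b where b: "xs = [b]"
    by (auto simp: length_Suc_conv)
  have real: "grp_sat H ((!) (b # bs)) \<phi>" if "\<phi> \<in> p" for \<phi>
    using xs(3) that by (simp add: b grp_realizes_def)
  \<comment> \<open>Realizing \<open>p\<close> gives one direction. For the other, a formula that
    fails in \<open>G\<close> has its negation in \<open>p\<close>.\<close>
  have "grp_sat G ((!) (a # as)) \<phi> \<longleftrightarrow> grp_sat H ((!) (b # bs)) \<phi>"
    if "grp_fv \<phi> \<subseteq> {..<Suc (length as)}" for \<phi>
    using real[of \<phi>] real[of "GNeg \<phi>"] that by (auto simp: p_def)
  then have "grp_same_type G H (a # as) (b # bs)"
    using xs(2) a as bs by (simp add: grp_same_type_def len b)
  then show ?thesis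
    using xs(2) b by auto
qed

text \<open>Finite partial maps are represented by their graphs.\<close>

definition back_forth ::
    "('a, 'm) monoid_scheme \<Rightarrow> ('b, 'n) monoid_scheme \<Rightarrow> ('a \<times> 'b) set set \<Rightarrow> bool" where
  "back_forth G H P \<longleftrightarrow> (\<forall>p\<in>P.
     finite p \<and> p \<subseteq> carrier G \<times> carrier H \<and>
     (\<forall>x y x' y'. (x, y) \<in> p \<longrightarrow> (x', y') \<in> p \<longrightarrow> (x = x' \<longleftrightarrow> y = y')) \<and>
     (\<forall>x y x' y' x'' y''. (x, y) \<in> p \<longrightarrow> (x', y') \<in> p \<longrightarrow> (x'', y'') \<in> p \<longrightarrow>
        (x \<otimes>\<^bsub>G\<^esub> x' = x'' \<longleftrightarrow> y \<otimes>\<^bsub>H\<^esub> y' = y'')) \<and>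
     (\<forall>a\<in>carrier G. \<exists>b\<in>carrier H. insert (a, b) p \<in> P) \<and>
     (\<forall>b\<in>carrier H. \<exists>a\<in>carrier G. insert (a, b) p \<in> P))"

lemma back_forthD:
  assumes "back_forth G H P" and "p \<in> P"
  shows "finite p" and "p \<subseteq> carrier G \<times> carrier H"
    and "(x, y) \<in> p \<Longrightarrow> (x', y') \<in> p \<Longrightarrow> x = x' \<longleftrightarrow> y = y'"
    and "(x, y) \<in> p \<Longrightarrow> (x', y') \<in> p \<Longrightarrow> (x'', y'') \<in> p \<Longrightarrow>
      x \<otimes>\<^bsub>G\<^esub> x' = x'' \<longleftrightarrow> y \<otimes>\<^bsub>H\<^esub> y' = y''"
    and "a \<in> carrier G \<Longrightarrow> \<exists>b\<in>carrier H. insert (a, b) p \<in> P"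
    and "b \<in> carrier H \<Longrightarrow> \<exists>a\<in>carrier G. insert (a, b) p \<in> P"
proof -
  note * = assms(1)[unfolded back_forth_def, THEN bspec, OF assms(2)]
  show "finite p" "p \<subseteq> carrier G \<times> carrier H"
    and "(x, y) \<in> p \<Longrightarrow> (x', y') \<in> p \<Longrightarrow> x = x' \<longleftrightarrow> y = y'"
    and "(x, y) \<in> p \<Longrightarrow> (x', y') \<in> p \<Longrightarrow> (x'', y'') \<in> p \<Longrightarrow>
      x \<otimes>\<^bsub>G\<^esub> x' = x'' \<longleftrightarrow> y \<otimes>\<^bsub>H\<^esub> y' = y''"
    and "a \<in> carrier G \<Longrightarrow> \<exists>b\<in>carrier H. insert (a, b) p \<in> P"
    and "b \<in> carrier H \<Longrightarrow> \<exists>a\<in>carrier G. insert (a, b) p \<in> P"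
    using * by blast+
qed

lemma converse_insert: "converse (insert (a, b) p) = insert (b, a) (converse p)"
  by auto

text \<open>The two sides play symmetric roles, so every result on passing from \<open>G\<close> to
  \<open>H\<close> can be applied backwards as well.\<close>

lemma back_forth_converse:
  assumes "back_forth G H P"
  shows "back_forth H G (converse ` P)"
  unfolding back_forth_def
proof (rule ballI, elim imageE)
  fix q p assume p: "p \<in> P" and q: "q = converse p"
  note * = back_forthD[OF assms p]
  have "finite q"
    using *(1) q by simp
  moreover have "q \<subseteq> carrier H \<times> carrier G"
    using *(2) q by auto
  moreover have "\<exists>b\<in>carrier G. insert (a, b) q \<in> converse ` P" if "a \<in> carrier H" for a
    using *(6)[OF that] q converse_insert by (metis imageI)
  moreover have "\<exists>a\<in>carrier H. insert (a, b) q \<in> converse ` P" if "b \<in> carrier G" for b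
    using *(5)[OF that] q converse_insert by (metis imageI)
  moreover have "x = x' \<longleftrightarrow> y = y'" if "(x, y) \<in> q" "(x', y') \<in> q" for x y x' y'
    using *(3)[of y x y' x'] that q by auto
  moreover have "x \<otimes>\<^bsub>H\<^esub> x' = x'' \<longleftrightarrow> y \<otimes>\<^bsub>G\<^esub> y' = y''"
    if "(x, y) \<in> q" "(x', y') \<in> q" "(x'', y'') \<in> q" for x y x' y' x'' y''
    using *(4)[of y x y' x' y'' x''] that q by auto
  ultimately show "finite q \<and> q \<subseteq> carrier H \<times> carrier G \<and>
     (\<forall>x y x' y'. (x, y) \<in> q \<longrightarrow> (x', y') \<in> q \<longrightarrow> (x = x' \<longleftrightarrow> y = y')) \<and>
     (\<forall>x y x' y' x'' y''. (x, y) \<in> q \<longrightarrow> (x', y') \<in> q \<longrightarrow> (x'', y'') \<in> q \<longrightarrow>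
        (x \<otimes>\<^bsub>H\<^esub> x' = x'' \<longleftrightarrow> y \<otimes>\<^bsub>G\<^esub> y' = y'')) \<and>
     (\<forall>a\<in>carrier H. \<exists>b\<in>carrier G. insert (a, b) q \<in> converse ` P) \<and>
     (\<forall>b\<in>carrier G. \<exists>a\<in>carrier H. insert (a, b) q \<in> converse ` P)"
    by blast
qed

text \<open>Equalities and products among entries are atomic formulas, on which tuples of the same
  type agree. Going forth uses saturation of \<open>H\<close>, going back that of
  \<open>G\<close>.\<close>

lemma back_forth_same_type:
  assumes "grp_omega_saturated G" and "grp_omega_saturated H"
  shows "back_forth G H {set (zip as bs) | as bs. grp_same_type G H as bs}" (is "back_forth G H ?P")
  unfolding back_forth_def
proof (rule ballI, clarify)
  fix as bs assume type: "grp_same_type G H as bs"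
  let ?p = "set (zip as bs)"
  have len: "length bs = length as" and as: "set as \<subseteq> carrier G" and bs: "set bs \<subseteq> carrier H"
    using type by (simp_all add: grp_same_type_def)
  have sat: "grp_sat G ((!) as) \<phi> \<longleftrightarrow> grp_sat H ((!) bs) \<phi>" if "grp_fv \<phi> \<subseteq> {..<length as}" for \<phi>
    using type that unfolding grp_same_type_def by blast
  have p: "\<exists>i<length as. x = as ! i \<and> y = bs ! i" if "(x, y) \<in> ?p" for x y
    using that by (auto simp: in_set_zip len)
  have "?p \<subseteq> carrier G \<times> carrier H"
    using as bs by (auto dest: set_zip_leftD set_zip_rightD)
  moreover have "x = x' \<longleftrightarrow> y = y'" if xy: "(x, y) \<in> ?p" "(x', y') \<in> ?p" for x y x' y'
  proof -
    from xy obtain i j where "i < length as" "j < length as" 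
      "x = as ! i" "y = bs ! i" "x' = as ! j" "y' = bs ! j"
      by (meson p)
    then show ?thesis
      using sat[of "GEq (GVar i) (GVar j)"] by simp
  qed
  moreover have "x \<otimes>\<^bsub>G\<^esub> x' = x'' \<longleftrightarrow> y \<otimes>\<^bsub>H\<^esub> y' = y''"
    if xy: "(x, y) \<in> ?p" "(x', y') \<in> ?p" "(x'', y'') \<in> ?p" for x y x' y' x'' y''
  proof -
    from xy obtain i j k where "i < length as" "j < length as" "k < length as"
      "x = as ! i" "y = bs ! i" "x' = as ! j" "y' = bs ! j" "x'' = as ! k" "y'' = bs ! k"
      by (meson p)
    then show ?thesis
      using sat[of "GEq (GMul (GVar i) (GVar j)) (GVar k)"] by simp
  qed
  moreover have "\<exists>b\<in>carrier H. insert (a, b) ?p \<in> ?P" if a: "a \<in> carrier G" for a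
  proof -
    obtain b where "b \<in> carrier H" "grp_same_type G H (a # as) (b # bs)"
      using grp_same_type_forth[OF type assms(2) a] by blast
    moreover have "insert (a, b) ?p = set (zip (a # as) (b # bs))"
      by simp
    ultimately show ?thesis by blast
  qed
  moreover have "\<exists>a\<in>carrier G. insert (a, b) ?p \<in> ?P" if b: "b \<in> carrier H" for b
  proof -
    obtain a where "a \<in> carrier G" "grp_same_type G H (a # as) (b # bs)"
      using grp_same_type_forth[OF grp_same_type_sym[OF type] assms(1) b] grp_same_type_sym by blast
    moreover have "insert (a, b) ?p = set (zip (a # as) (b # bs))"
      by simp
    ultimately show ?thesis by blast
  qed
  ultimately show "finite ?p \<and> ?p \<subseteq> carrier G \<times> carrier H \<and>
     (\<forall>x y x' y'. (x, y) \<in> ?p \<longrightarrow> (x', y') \<in> ?p \<longrightarrow> (x = x' \<longleftrightarrow> y = y')) \<and>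
     (\<forall>x y x' y' x'' y''. (x, y) \<in> ?p \<longrightarrow> (x', y') \<in> ?p \<longrightarrow> (x'', y'') \<in> ?p \<longrightarrow>
        (x \<otimes>\<^bsub>G\<^esub> x' = x'' \<longleftrightarrow> y \<otimes>\<^bsub>H\<^esub> y' = y'')) \<and>
     (\<forall>a\<in>carrier G. \<exists>b\<in>carrier H. insert (a, b) ?p \<in> ?P) \<and>
     (\<forall>b\<in>carrier H. \<exists>a\<in>carrier G. insert (a, b) ?p \<in> ?P)"
    by (intro conjI) (blast | simp)+
qed

section \<open>The convolution algebra\<close>

text \<open>A single domination principle for all pointwise operations: \<open>c\<close> is 1 for
  differences and 1/2 for the rescaled operations, and \<open>g\<close> may be zero when one
  function suffices.\<close>

lemma l1_dominated:
  assumes "f \<in> l1 G" and "g \<in> l1 G"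
    and "\<And>x. x \<notin> carrier G \<Longrightarrow> h x = 0" and bound: "\<And>x. \<bar>h x\<bar> \<le> c * (\<bar>f x\<bar> + \<bar>g x\<bar>)"
  shows "h \<in> l1 G" and "l1_norm G h \<le> c * (l1_norm G f + l1_norm G g)"
proof -
  have f: "(\<lambda>x. \<bar>f x\<bar>) summable_on carrier G" and g: "(\<lambda>x. \<bar>g x\<bar>) summable_on carrier G"
    using assms(1,2) by (auto simp: l1_def)
  have fg: "(\<lambda>x. c * (\<bar>f x\<bar> + \<bar>g x\<bar>)) summable_on carrier G"
    by (intro summable_on_cmult_right summable_on_add f g)
  have h: "(\<lambda>x. \<bar>h x\<bar>) summable_on carrier G"
    by (rule summable_on_comparison_test[OF fg]) (use bound in auto)
  then show "h \<in> l1 G"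
    using assms(3) by (simp add: l1_def)
  have "l1_norm G h \<le> (\<Sum>\<^sub>\<infinity>x\<in>carrier G. c * (\<bar>f x\<bar> + \<bar>g x\<bar>))"
    unfolding l1_norm_def by (rule infsum_mono[OF h fg]) (rule bound)
  also have "\<dots> = c * (l1_norm G f + l1_norm G g)"
    by (simp add: infsum_cmult_right' infsum_add[OF f g] l1_norm_def)
  finally show "l1_norm G h \<le> c * (l1_norm G f + l1_norm G g)" .
qed

lemma l1_zero: "(\<lambda>x. 0) \<in> l1 G"
  by (simp add: l1_def)

lemma l1_norm_zero: "l1_norm G (\<lambda>x. 0) = 0"
  by (simp add: l1_norm_def)

lemma l1_norm_nonneg: "0 \<le> l1_norm G f"
  by (simp add: l1_norm_def infsum_nonneg)

lemma l1_vanish: "f \<in> l1 G \<Longrightarrow> x \<notin> carrier G \<Longrightarrow> f x = 0"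
  by (simp add: l1_def)

lemma l1_diff:
  assumes "f \<in> l1 G" and "g \<in> l1 G"
  shows "(\<lambda>x. f x - g x) \<in> l1 G"
    and "l1_norm G (\<lambda>x. f x - g x) \<le> l1_norm G f + l1_norm G g"
  using l1_dominated[OF assms, of "\<lambda>x. f x - g x" 1] assms by (auto simp: l1_vanish abs_triangle_ineq4)

text \<open>The reverse triangle inequality: each of the two functions is dominated by the other
  together with the difference.\<close>

lemma l1_norm_diff_norm:
  assumes "f \<in> l1 G" and "g \<in> l1 G"
  shows "\<bar>l1_norm G f - l1_norm G g\<bar> \<le> l1_norm G (\<lambda>x. f x - g x)"
proof -
  have "l1_norm G f \<le> 1 * (l1_norm G (\<lambda>x. f x - g x) + l1_norm G g)"
    by (rule l1_dominated(2)[OF l1_diff(1)[OF assms] assms(2)]) (use assms in \<open>auto simp: l1_vanish\<close>)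
  moreover have "l1_norm G g \<le> 1 * (l1_norm G (\<lambda>x. f x - g x) + l1_norm G f)"
    by (rule l1_dominated(2)[OF l1_diff(1)[OF assms] assms(1)]) (use assms in \<open>auto simp: l1_vanish\<close>)
  ultimately show ?thesis
    by (simp add: abs_le_iff)
qed

lemma l1_ballD:
  assumes "f \<in> l1_ball G"
  shows "f \<in> l1 G" and "l1_norm G f \<le> 1"
  using assms by (auto simp: l1_ball_def)

lemma l1_ball_zero: "(\<lambda>x. 0) \<in> l1_ball G"
  by (simp add: l1_ball_def l1_zero l1_norm_zero)

text \<open>Truncating \<open>f\<close> to a finite set that carries all but \<epsilon> of its norm
  only decreases absolute values, so the result stays in the ball; the error is the tail of the norm
  series.\<close>

lemma l1_ball_finite_support_approx:
  assumes f: "f \<in> l1_ball G" and "0 < \<epsilon>"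
  shows "\<exists>f'\<in>l1_ball G. finite {x. f' x \<noteq> 0} \<and> l1_norm G (\<lambda>x. f x - f' x) \<le> \<epsilon>"
proof -
  have sum: "(\<lambda>x. \<bar>f x\<bar>) summable_on carrier G"
    using l1_ballD(1)[OF f] by (simp add: l1_def)
  from infsum_finite_approximation[OF this \<open>0 < \<epsilon>\<close>] obtain F
    where F: "finite F" "F \<subseteq> carrier G"
      and dist: "dist (\<Sum>x\<in>F. \<bar>f x\<bar>) (\<Sum>\<^sub>\<infinity>x\<in>carrier G. \<bar>f x\<bar>) \<le> \<epsilon>"
    by blast
  define f' where "f' x = (if x \<in> F then f x else 0)" for x
  have "\<bar>f' x\<bar> \<le> 1 * (\<bar>f x\<bar> + \<bar>0\<bar>)" "x \<notin> carrier G \<Longrightarrow> f' x = 0" for x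
    using l1_ballD(1)[OF f] by (auto simp: f'_def l1_vanish)
  from l1_dominated[OF l1_ballD(1)[OF f] l1_zero this(2,1)] have "f' \<in> l1_ball G"
    using l1_ballD(2)[OF f] by (simp add: l1_ball_def l1_norm_zero)
  moreover have "finite {x. f' x \<noteq> 0}"
    by (rule finite_subset[OF _ F(1)]) (auto simp: f'_def)
  moreover have "l1_norm G (\<lambda>x. f x - f' x) = (\<Sum>\<^sub>\<infinity>x\<in>carrier G - F. \<bar>f x\<bar>)"
    unfolding l1_norm_def by (rule infsum_cong_neutral) (auto simp: f'_def)
  moreover have "\<dots> = (\<Sum>\<^sub>\<infinity>x\<in>carrier G. \<bar>f x\<bar>) - (\<Sum>x\<in>F. \<bar>f x\<bar>)"
    using F sum by (subst infsum_Diff) auto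
  ultimately show ?thesis
    using dist by (auto simp: dist_real_def intro!: bexI[of _ f'])
qed

section \<open>Convolution: convergence, submultiplicativity and continuity\<close>

lemma bij_betw_left_translate:
  assumes "group G" and "y \<in> carrier G"
  shows "bij_betw (\<lambda>x. inv\<^bsub>G\<^esub> y \<otimes>\<^bsub>G\<^esub> x) (carrier G) (carrier G)"
proof -
  interpret group G by fact
  show ?thesis
    by (rule bij_betw_byWitness[of _ "\<lambda>x. y \<otimes>\<^bsub>G\<^esub> x"])
      (use assms(2) in \<open>auto simp: m_assoc[symmetric]\<close>)
qed

text \<open>Fubini. For fixed \<open>y\<close>, left translation permutes the group, so summing over
  \<open>x\<close> first gives \<open>\<bar>f y\<bar> * l1_norm G g\<close>; hence the family is
  absolutely summable on the product and the order of summation may be exchanged.\<close>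

lemma conv_double_sum:
  assumes "group G" and "f \<in> l1 G" and "g \<in> l1 G"
  defines "F \<equiv> (\<lambda>y x. f y * g (inv\<^bsub>G\<^esub> y \<otimes>\<^bsub>G\<^esub> x))"
  shows "x \<in> carrier G \<Longrightarrow> (\<lambda>y. \<bar>F y x\<bar>) summable_on carrier G"
    and "(\<lambda>x. \<Sum>\<^sub>\<infinity>y\<in>carrier G. \<bar>F y x\<bar>) summable_on carrier G"
    and "(\<Sum>\<^sub>\<infinity>x\<in>carrier G. \<Sum>\<^sub>\<infinity>y\<in>carrier G. \<bar>F y x\<bar>) = l1_norm G f * l1_norm G g"
proof -
  let ?C = "carrier G"
  have f: "(\<lambda>x. \<bar>f x\<bar>) summable_on ?C" and g: "(\<lambda>x. \<bar>g x\<bar>) summable_on ?C"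
    using assms(2,3) by (auto simp: l1_def)
  have inner: "(\<lambda>x. \<bar>F y x\<bar>) summable_on ?C" "(\<Sum>\<^sub>\<infinity>x\<in>?C. \<bar>F y x\<bar>) = \<bar>f y\<bar> * l1_norm G g"
    if "y \<in> ?C" for y
  proof -
    note bij = bij_betw_left_translate[OF \<open>group G\<close> that]
    have "(\<lambda>x. \<bar>g (inv\<^bsub>G\<^esub> y \<otimes>\<^bsub>G\<^esub> x)\<bar>) summable_on ?C"
      using summable_on_reindex_bij_betw[OF bij, of "\<lambda>x. \<bar>g x\<bar>"] g by simp
    then show "(\<lambda>x. \<bar>F y x\<bar>) summable_on ?C"
      unfolding F_def abs_mult by (rule summable_on_cmult_right)
    show "(\<Sum>\<^sub>\<infinity>x\<in>?C. \<bar>F y x\<bar>) = \<bar>f y\<bar> * l1_norm G g"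
      using infsum_reindex_bij_betw[OF bij, of "\<lambda>x. \<bar>g x\<bar>"]
      by (simp add: F_def abs_mult infsum_cmult_right' l1_norm_def)
  qed
  have outer: "(\<lambda>y. \<Sum>\<^sub>\<infinity>x\<in>?C. \<bar>F y x\<bar>) summable_on ?C"
    using summable_on_cmult_left[OF f, of "l1_norm G g"]
    by (subst summable_on_cong[of _ _ "\<lambda>y. \<bar>f y\<bar> * l1_norm G g"]) (auto simp: inner(2))
  have prod: "(\<lambda>(y, x). F y x) abs_summable_on (?C \<times> ?C)"
    unfolding abs_summable_on_Sigma_iff using inner(1) outer by (simp add: infsum_nonneg)
  \<comment> \<open>Swapping the factors turns information about sums over \<open>x\<close> into
    information about the sums over \<open>y\<close> that define the convolution.\<close>
  then have prod': "(\<lambda>(x, y). F y x) abs_summable_on (?C \<times> ?C)"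
    using summable_on_swap[of "\<lambda>z. norm (case z of (y, x) \<Rightarrow> F y x)" ?C ?C]
    by (simp add: case_prod_unfold comp_def)
  then show "x \<in> ?C \<Longrightarrow> (\<lambda>y. \<bar>F y x\<bar>) summable_on ?C"
    unfolding abs_summable_on_Sigma_iff by auto
  show "(\<lambda>x. \<Sum>\<^sub>\<infinity>y\<in>?C. \<bar>F y x\<bar>) summable_on ?C"
    using prod' unfolding abs_summable_on_Sigma_iff by (simp add: infsum_nonneg)
  have "(\<Sum>\<^sub>\<infinity>x\<in>?C. \<Sum>\<^sub>\<infinity>y\<in>?C. \<bar>F y x\<bar>) = (\<Sum>\<^sub>\<infinity>y\<in>?C. \<Sum>\<^sub>\<infinity>x\<in>?C. \<bar>F y x\<bar>)"
    by (rule infsum_swap_banach) (use prod' in \<open>simp add: case_prod_unfold\<close>)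
  also have "\<dots> = (\<Sum>\<^sub>\<infinity>y\<in>?C. \<bar>f y\<bar> * l1_norm G g)"
    by (rule infsum_cong) (simp add: inner(2))
  also have "\<dots> = l1_norm G f * l1_norm G g"
    by (simp add: infsum_cmult_left' l1_norm_def)
  finally show "(\<Sum>\<^sub>\<infinity>x\<in>?C. \<Sum>\<^sub>\<infinity>y\<in>?C. \<bar>F y x\<bar>) = l1_norm G f * l1_norm G g" .
qed

lemma conv_l1:
  assumes "group G" and "f \<in> l1 G" and "g \<in> l1 G"
  shows "conv G f g \<in> l1 G" and "l1_norm G (conv G f g) \<le> l1_norm G f * l1_norm G g"
proof -
  note sums = conv_double_sum[OF assms]
  have bound: "\<bar>conv G f g x\<bar> \<le> (\<Sum>\<^sub>\<infinity>y\<in>carrier G. \<bar>f y * g (inv\<^bsub>G\<^esub> y \<otimes>\<^bsub>G\<^esub> x)\<bar>)"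
    if "x \<in> carrier G" for x
    using norm_infsum_bound[of "\<lambda>y. f y * g (inv\<^bsub>G\<^esub> y \<otimes>\<^bsub>G\<^esub> x)" "carrier G"] sums(1)[OF that] that
    by (simp add: conv_def)
  have sum: "(\<lambda>x. \<bar>conv G f g x\<bar>) summable_on carrier G"
    by (rule summable_on_comparison_test[OF sums(2)]) (use bound in auto)
  then show "conv G f g \<in> l1 G"
    by (simp add: l1_def conv_def)
  show "l1_norm G (conv G f g) \<le> l1_norm G f * l1_norm G g"
    unfolding sums(3)[symmetric] unfolding l1_norm_def by (rule infsum_mono[OF sum sums(2)]) (rule bound)
qed

text \<open>Bilinearity, with the convolution of \<open>f'\<close> and \<open>g\<close> as the
  intermediate term.\<close>

lemma conv_diff:
  assumes "group G" and "f \<in> l1 G" and "f' \<in> l1 G" and "g \<in> l1 G" and "g' \<in> l1 G"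
  shows "conv G f g x - conv G f' g' x =
    conv G (\<lambda>x. f x - f' x) g x + conv G f' (\<lambda>x. g x - g' x) x"
proof (cases "x \<in> carrier G")
  case True
  have sum: "(\<lambda>y. h y * k (inv\<^bsub>G\<^esub> y \<otimes>\<^bsub>G\<^esub> x)) summable_on carrier G" if "h \<in> l1 G" "k \<in> l1 G" for h k
    by (rule abs_summable_summable) (use conv_double_sum(1)[OF assms(1) that True] in simp)
  have "conv G f g x = conv G (\<lambda>x. f x - f' x) g x + conv G f' g x"
    using True infsum_add[OF sum sum, of "\<lambda>x. f x - f' x" g f' g] assms
    by (simp add: conv_def l1_diff algebra_simps)
  moreover have "conv G f' g x = conv G f' (\<lambda>x. g x - g' x) x + conv G f' g' x"
    using True infsum_add[OF sum sum, of f' "\<lambda>x. g x - g' x" f' g'] assms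
    by (simp add: conv_def l1_diff algebra_simps)
  ultimately show ?thesis
    by simp
qed (simp add: conv_def)

text \<open>By submultiplicativity the two remaining factors \<open>g\<close> and \<open>f'\<close>
  contribute norms at most 1, so on the unit ball convolution is 1-Lipschitz in each
  argument.\<close>

lemma l1_norm_conv_diff:
  assumes "group G" and "f \<in> l1_ball G" and "f' \<in> l1_ball G" and "g \<in> l1_ball G" and "g' \<in> l1_ball G"
  shows "l1_norm G (\<lambda>x. conv G f g x - conv G f' g' x) \<le>
    l1_norm G (\<lambda>x. f x - f' x) + l1_norm G (\<lambda>x. g x - g' x)"
proof -
  let ?f = "\<lambda>x. f x - f' x" and ?g = "\<lambda>x. g x - g' x"
  note l1 = assms(2-5)[THEN l1_ballD(1)] and le1 = assms(2-5)[THEN l1_ballD(2)]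
  have "l1_norm G (\<lambda>x. conv G f g x - conv G f' g' x) \<le>
      1 * (l1_norm G (conv G ?f g) + l1_norm G (conv G f' ?g))"
    unfolding conv_diff[OF assms(1) l1]
    by (rule l1_dominated(2)) (auto simp: conv_def intro!: conv_l1 l1_diff l1 assms(1))
  also have "\<dots> \<le> l1_norm G ?f * l1_norm G g + l1_norm G f' * l1_norm G ?g"
    using conv_l1(2)[OF assms(1) l1_diff(1)[OF l1(1,2)] l1(3)]
      conv_l1(2)[OF assms(1) l1(2) l1_diff(1)[OF l1(3,4)]] by simp
  also have "\<dots> \<le> l1_norm G ?f + l1_norm G ?g"
    using le1 by (intro add_mono mult_left_le mult_left_le_one_le) (auto simp: l1_norm_nonneg)
  finally show ?thesis .
qed

section \<open>Values of terms in the unit ball and their Lipschitz dependence on the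
  assignment\<close>

lemma l1_ball_half:
  assumes "f \<in> l1_ball G" and "g \<in> l1_ball G"
    and "\<And>x. f x = 0 \<Longrightarrow> g x = 0 \<Longrightarrow> h x = 0" and "\<And>x. \<bar>h x\<bar> \<le> 1/2 * (\<bar>f x\<bar> + \<bar>g x\<bar>)"
  shows "h \<in> l1_ball G"
proof -
  note l1 = assms(1,2)[THEN l1_ballD(1)]
  have "x \<notin> carrier G \<Longrightarrow> h x = 0" for x
    using assms(3) l1[THEN l1_vanish] by blast
  from l1_dominated[OF l1 this assms(4)] show ?thesis
    using assms(1,2)[THEN l1_ballD(2)] by (simp add: l1_ball_def)
qed

lemma cnv_eval_ball:
  assumes "group G" and "\<And>i. v i \<in> l1_ball G"
  shows "cnv_eval G v t \<in> l1_ball G"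
proof (induction t)
  case (CVar i)
  then show ?case by (simp add: assms)
next
  case CZero
  then show ?case by (simp add: l1_ball_zero)
next
  case (CPlus s t)
  then show ?case by (rule l1_ball_half) auto
next
  case (CMeet s t)
  then show ?case by (rule l1_ball_half) (auto simp: min_def)
next
  case (CJoin s t)
  then show ?case by (rule l1_ball_half) (auto simp: max_def)
next
  case (CConv s t)
  note l1 = CConv[THEN l1_ballD(1)] and le1 = CConv[THEN l1_ballD(2)]
  have "l1_norm G (cnv_eval G v s) * l1_norm G (cnv_eval G v t) \<le> 1"
    using le1 by (simp add: mult_le_one l1_norm_nonneg)
  then show ?case
    using conv_l1[OF assms(1) l1] by (simp add: l1_ball_def)
qed

text \<open>The factor \<open>1 *\<close> brings the bounds into the form that
  \<open>l1_dominated\<close> expects.\<close>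

lemma half_operations_close:
  fixes a b c d :: real
  shows "\<bar>(a + b) / 2 - (c + d) / 2\<bar> \<le> 1 * (\<bar>a - c\<bar> + \<bar>b - d\<bar>)"
    and "\<bar>min a b / 2 - min c d / 2\<bar> \<le> 1 * (\<bar>a - c\<bar> + \<bar>b - d\<bar>)"
    and "\<bar>max a b / 2 - max c d / 2\<bar> \<le> 1 * (\<bar>a - c\<bar> + \<bar>b - d\<bar>)"
proof -
  have half: "\<bar>p / 2 - q / 2\<bar> \<le> 1 * s" if "\<bar>p - q\<bar> \<le> s" for p q s :: real
    using that unfolding diff_divide_distrib[symmetric] abs_divide by simp
  show "\<bar>(a + b) / 2 - (c + d) / 2\<bar> \<le> 1 * (\<bar>a - c\<bar> + \<bar>b - d\<bar>)"
    by (rule half) linarith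
  show "\<bar>min a b / 2 - min c d / 2\<bar> \<le> 1 * (\<bar>a - c\<bar> + \<bar>b - d\<bar>)"
    by (rule half) (auto simp: min_def abs_if)
  show "\<bar>max a b / 2 - max c d / 2\<bar> \<le> 1 * (\<bar>a - c\<bar> + \<bar>b - d\<bar>)"
    by (rule half) (auto simp: max_def abs_if)
qed

text \<open>Every operation is 1-Lipschitz in each argument on the ball, so the constants of
  subterms add up; the induction yields the number of occurrences of variables in
  \<open>t\<close>.\<close>

lemma cnv_eval_Lipschitz:
  fixes G :: "('a, 'm) monoid_scheme"
  assumes "group G"
  shows "\<exists>L\<ge>0. \<forall>(v :: nat \<Rightarrow> 'a \<Rightarrow> real) w \<delta>. range v \<subseteq> l1_ball G \<longrightarrow> range w \<subseteq> l1_ball G \<longrightarrow>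
    (\<forall>i. l1_norm G (\<lambda>x. v i x - w i x) \<le> \<delta>) \<longrightarrow>
    l1_norm G (\<lambda>x. cnv_eval G v t x - cnv_eval G w t x) \<le> L * \<delta>"
    (is "\<exists>L\<ge>0. ?Lip t L")
proof (induction t)
  case (CVar i)
  then show ?case by (intro exI[of _ 1]) auto
next
  case CZero
  then show ?case by (intro exI[of _ 0]) (auto simp: l1_norm_zero)
next
  \<comment> \<open>Shared by the three pointwise operations: a pointwise estimate by the changes of
    the two subterms integrates to an estimate of norms.\<close>
  have half: "?Lip r (L + M)" if L: "?Lip s L" and M: "?Lip t M"
    and r: "\<And>v w x. \<bar>cnv_eval G v r x - cnv_eval G w r x\<bar> \<le>
       1 * (\<bar>cnv_eval G v s x - cnv_eval G w s x\<bar> + \<bar>cnv_eval G v t x - cnv_eval G w t x\<bar>)"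
    for L M r s t
  proof (intro allI impI)
    fix v w :: "nat \<Rightarrow> 'a \<Rightarrow> real" and \<delta>
    assume vw: "range v \<subseteq> l1_ball G" "range w \<subseteq> l1_ball G"
      "\<forall>i. l1_norm G (\<lambda>x. v i x - w i x) \<le> \<delta>"
    have ball: "cnv_eval G v u \<in> l1 G" "cnv_eval G w u \<in> l1 G" for u
      using cnv_eval_ball[OF assms] vw(1,2) by (blast intro: l1_ballD(1))+
    have "l1_norm G (\<lambda>x. cnv_eval G v r x - cnv_eval G w r x) \<le>
      1 * (l1_norm G (\<lambda>x. cnv_eval G v s x - cnv_eval G w s x) +
        l1_norm G (\<lambda>x. cnv_eval G v t x - cnv_eval G w t x))"
      by (rule l1_dominated(2)) (use r in \<open>auto intro: l1_diff ball simp: ball[THEN l1_vanish]\<close>)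
    also have "\<dots> \<le> (L + M) * \<delta>"
      using L M vw by (simp add: distrib_right add_mono)
    finally show "l1_norm G (\<lambda>x. cnv_eval G v r x - cnv_eval G w r x) \<le> (L + M) * \<delta>" .
  qed
  {
    case (CPlus s t)
    then obtain L M where "L \<ge> 0" "M \<ge> 0" and LM: "?Lip s L" "?Lip t M" by blast
    have "?Lip (CPlus s t) (L + M)"
      by (rule half[OF LM]) (simp only: cnv_eval.simps half_operations_close)
    then show ?case
      using \<open>L \<ge> 0\<close> \<open>M \<ge> 0\<close> by (intro exI[of _ "L + M"] conjI add_nonneg_nonneg)
  next
    case (CMeet s t)
    then obtain L M where "L \<ge> 0" "M \<ge> 0" and LM: "?Lip s L" "?Lip t M" by blast
    have "?Lip (CMeet s t) (L + M)"
      by (rule half[OF LM]) (simp only: cnv_eval.simps half_operations_close)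
    then show ?case
      using \<open>L \<ge> 0\<close> \<open>M \<ge> 0\<close> by (intro exI[of _ "L + M"] conjI add_nonneg_nonneg)
  next
    case (CJoin s t)
    then obtain L M where "L \<ge> 0" "M \<ge> 0" and LM: "?Lip s L" "?Lip t M" by blast
    have "?Lip (CJoin s t) (L + M)"
      by (rule half[OF LM]) (simp only: cnv_eval.simps half_operations_close)
    then show ?case
      using \<open>L \<ge> 0\<close> \<open>M \<ge> 0\<close> by (intro exI[of _ "L + M"] conjI add_nonneg_nonneg)
  }
next
  case (CConv s t)
  then obtain L M where "L \<ge> 0" and L: "?Lip s L" and "M \<ge> 0" and M: "?Lip t M" by blast
  moreover have "?Lip (CConv s t) (L + M)"
  proof (intro allI impI)
    fix v w :: "nat \<Rightarrow> 'a \<Rightarrow> real" and \<delta>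
    assume vw: "range v \<subseteq> l1_ball G" "range w \<subseteq> l1_ball G"
      "\<forall>i. l1_norm G (\<lambda>x. v i x - w i x) \<le> \<delta>"
    have ball: "cnv_eval G v u \<in> l1_ball G" "cnv_eval G w u \<in> l1_ball G" for u
      using cnv_eval_ball[OF assms] vw(1,2) by blast+
    have "l1_norm G (\<lambda>x. cnv_eval G v (CConv s t) x - cnv_eval G w (CConv s t) x) \<le>
      l1_norm G (\<lambda>x. cnv_eval G v s x - cnv_eval G w s x) +
        l1_norm G (\<lambda>x. cnv_eval G v t x - cnv_eval G w t x)"
      using l1_norm_conv_diff[OF assms ball(1,2)[of s] ball(1,2)[of t]] by simp
    also have "\<dots> \<le> (L + M) * \<delta>"
      using L M vw by (simp add: distrib_right add_mono)
    finally show "l1_norm G (\<lambda>x. cnv_eval G v (CConv s t) x - cnv_eval G w (CConv s t) x)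
      \<le> (L + M) * \<delta>" .
  qed
  ultimately show ?case
    by (intro exI[of _ "L + M"] conjI add_nonneg_nonneg)
qed

section \<open>Uniform continuity of formulas\<close>

text \<open>Tychonoff: the set is a product of compact intervals. Connectives take whole sequences
  as arguments, so compactness is meant in the product topology.\<close>

lemma compact_bounded_functions: "compact {x :: nat \<Rightarrow> real. \<forall>i. \<bar>x i\<bar> \<le> B}"
proof -
  have "{x :: nat \<Rightarrow> real. \<forall>i. \<bar>x i\<bar> \<le> B} = PiE UNIV (\<lambda>_. {-B..B})"
    by (auto simp: PiE_iff abs_le_iff minus_le_iff)
  then show ?thesis
    using compactin_PiE[of "\<lambda>_. euclidean :: real topology" UNIV "\<lambda>_::nat. {-B..B}"]
    by (simp add: euclidean_product_topology)
qed

lemma connective_bounded: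
  fixes u :: "(nat \<Rightarrow> real) \<Rightarrow> real"
  assumes "continuous_on UNIV u"
  shows "\<exists>C. \<forall>x. (\<forall>i. \<bar>x i\<bar> \<le> B) \<longrightarrow> \<bar>u x\<bar> \<le> C"
proof -
  have "bounded (u ` {x. \<forall>i. \<bar>x i\<bar> \<le> B})"
    using assms compact_bounded_functions
    by (intro compact_imp_bounded compact_continuous_image) (auto intro: continuous_on_subset)
  then show ?thesis
    by (auto simp: bounded_iff)
qed

text \<open>The product metric weights coordinates geometrically: those up to \<open>N\<close>
  contribute at most \<open>2 * \<delta>\<close>, the remaining ones at most
  \<open>(1/2) ^ N\<close>.\<close>

lemma dist_fun_le:
  fixes x y :: "nat \<Rightarrow> real"
  assumes "\<And>i. \<bar>x i - y i\<bar> \<le> \<delta>"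
  shows "dist x y \<le> 2 * \<delta> + (1/2) ^ N"
proof -
  have "Max {dist (x (from_nat n)) (y (from_nat n)) | n. n \<le> N} \<le> \<delta>"
    using assms by (intro Max.boundedI) (auto simp: dist_real_def)
  then show ?thesis
    using dist_fun_le_dist_first_terms[of x y N] by simp
qed

text \<open>Heine-Cantor on the compact box, with closeness in the product metric replaced by
  uniform closeness of all coordinates.\<close>

lemma connective_uniformly_continuous:
  fixes u :: "(nat \<Rightarrow> real) \<Rightarrow> real"
  assumes "continuous_on UNIV u" and "0 < \<epsilon>"
  shows "\<exists>\<delta>>0. \<forall>x y. (\<forall>i. \<bar>x i\<bar> \<le> B) \<longrightarrow> (\<forall>i. \<bar>y i\<bar> \<le> B) \<longrightarrow> (\<forall>i. \<bar>x i - y i\<bar> \<le> \<delta>) \<longrightarrow>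
    \<bar>u x - u y\<bar> \<le> \<epsilon>"
proof -
  have "uniformly_continuous_on {x. \<forall>i. \<bar>x i\<bar> \<le> B} u"
    using assms compact_bounded_functions
    by (intro compact_uniformly_continuous) (auto intro: continuous_on_subset)
  from this[unfolded uniformly_continuous_on_def, rule_format, OF \<open>0 < \<epsilon>\<close>] obtain d where "0 < d"
    and d: "\<forall>x\<in>{x. \<forall>i. \<bar>x i\<bar> \<le> B}. \<forall>x'\<in>{x. \<forall>i. \<bar>x i\<bar> \<le> B}. dist x' x < d \<longrightarrow> dist (u x') (u x) < \<epsilon>"
    by blast
  \<comment> \<open>With coordinates within \<open>d / 4\<close>, the leading ones account for
    \<open>d / 2\<close> and the tail for less than \<open>d / 2\<close>.\<close>
  obtain N where N: "(1/2) ^ N < d / 2"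
    using real_arch_pow_inv[of "d / 2" "1/2"] \<open>0 < d\<close> by auto
  have "\<bar>u x - u y\<bar> \<le> \<epsilon>"
    if "\<forall>i. \<bar>x i\<bar> \<le> B" "\<forall>i. \<bar>y i\<bar> \<le> B" "\<forall>i. \<bar>x i - y i\<bar> \<le> d / 4" for x y
  proof -
    have "dist x y < d"
      using dist_fun_le[of x y "d / 4" N] that(3) N by simp
    then have "dist (u x) (u y) < \<epsilon>"
      using d that(1,2) by blast
    then show ?thesis
      by (simp add: dist_real_def)
  qed
  then show ?thesis
    using \<open>0 < d\<close> by (intro exI[of _ "d / 4"]) auto
qed

section \<open>Comparison of suprema and infima over two index sets\<close>

text \<open>Boundedness of \<open>g\<close> is what makes its real supremum and infimum genuine
  bounds. The index sets are kept separate so that they can be the unit balls of two groups.\<close>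

lemma cSUP_le_close:
  fixes f :: "'a \<Rightarrow> real" and g :: "'b \<Rightarrow> real"
  assumes "A \<noteq> {}" and "\<And>b. b \<in> B \<Longrightarrow> \<bar>g b\<bar> \<le> K"
    and close: "\<And>a. a \<in> A \<Longrightarrow> \<exists>b\<in>B. \<bar>f a - g b\<bar> \<le> \<epsilon>"
  shows "(SUP a\<in>A. f a) \<le> (SUP b\<in>B. g b) + \<epsilon>" and "(INF b\<in>B. g b) \<le> (INF a\<in>A. f a) + \<epsilon>"
proof -
  have bdd: "bdd_above (g ` B)" "bdd_below (g ` B)"
    using assms(2) by (intro bdd_aboveI2[of _ _ K] bdd_belowI2[of _ "-K"]; force simp: abs_le_iff)+
  have bounds: "f a \<le> (SUP b\<in>B. g b) + \<epsilon>" "(INF b\<in>B. g b) - \<epsilon> \<le> f a" if a: "a \<in> A" for a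
  proof -
    obtain b where "b \<in> B" "\<bar>f a - g b\<bar> \<le> \<epsilon>"
      using close[OF a] by blast
    moreover from this have "g b \<le> (SUP b\<in>B. g b)" "(INF b\<in>B. g b) \<le> g b"
      using bdd by (auto intro: cSUP_upper cINF_lower)
    ultimately show "f a \<le> (SUP b\<in>B. g b) + \<epsilon>" "(INF b\<in>B. g b) - \<epsilon> \<le> f a"
      by linarith+
  qed
  show "(SUP a\<in>A. f a) \<le> (SUP b\<in>B. g b) + \<epsilon>"
    by (rule cSUP_least[OF assms(1) bounds(1)])
  have "(INF b\<in>B. g b) - \<epsilon> \<le> (INF a\<in>A. f a)"
    by (rule cINF_greatest[OF assms(1) bounds(2)])
  then show "(INF b\<in>B. g b) \<le> (INF a\<in>A. f a) + \<epsilon>"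
    by simp
qed

lemma cSUP_cINF_close:
  fixes f :: "'a \<Rightarrow> real" and g :: "'b \<Rightarrow> real"
  assumes "A \<noteq> {}" and "B \<noteq> {}"
    and "\<And>a. a \<in> A \<Longrightarrow> \<bar>f a\<bar> \<le> K" and "\<And>b. b \<in> B \<Longrightarrow> \<bar>g b\<bar> \<le> L"
    and "\<And>a. a \<in> A \<Longrightarrow> \<exists>b\<in>B. \<bar>f a - g b\<bar> \<le> \<epsilon>" and "\<And>b. b \<in> B \<Longrightarrow> \<exists>a\<in>A. \<bar>f a - g b\<bar> \<le> \<epsilon>"
  shows "\<bar>(SUP a\<in>A. f a) - (SUP b\<in>B. g b)\<bar> \<le> \<epsilon>" and "\<bar>(INF a\<in>A. f a) - (INF b\<in>B. g b)\<bar> \<le> \<epsilon>"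
proof -
  note AB = cSUP_le_close[of A B g L f \<epsilon>, OF assms(1,4,5)]
  have "\<And>b. b \<in> B \<Longrightarrow> \<exists>a\<in>A. \<bar>g b - f a\<bar> \<le> \<epsilon>"
    using assms(6) by (simp add: abs_minus_commute)
  note BA = cSUP_le_close[of B A f K g \<epsilon>, OF assms(2,3) this]
  show "\<bar>(SUP a\<in>A. f a) - (SUP b\<in>B. g b)\<bar> \<le> \<epsilon>" "\<bar>(INF a\<in>A. f a) - (INF b\<in>B. g b)\<bar> \<le> \<epsilon>"
    using AB BA by (simp_all add: abs_le_iff)
qed

text \<open>The bound is uniform in the assignment: subformulas take values in a box, and a
  continuous connective is bounded there. It is needed to make quantifiers well behaved.\<close>

lemma cnv_val_bounded:
  fixes G :: "('a, 'm) monoid_scheme"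
  assumes "group G" and "cnv_wf \<phi>"
  shows "\<exists>B. \<forall>v. range v \<subseteq> l1_ball G \<longrightarrow> \<bar>cnv_val G v \<phi>\<bar> \<le> B"
  using assms(2)
proof (induction \<phi>)
  case (CDist s t)
  have "\<bar>cnv_val G v (CDist s t)\<bar> \<le> 2" if "range v \<subseteq> l1_ball G" for v
  proof -
    have ball: "cnv_eval G v u \<in> l1_ball G" for u
      using cnv_eval_ball[OF assms(1)] that by blast
    show ?thesis
      using l1_diff(2)[OF ball[THEN l1_ballD(1)] ball[THEN l1_ballD(1)], of s t]
        l1_ballD(2)[OF ball, of s] l1_ballD(2)[OF ball, of t] by (simp add: l1_norm_nonneg)
  qed
  then show ?case by blast
next
  case (CNorm t)
  have "\<bar>cnv_val G v (CNorm t)\<bar> \<le> 1" if "range v \<subseteq> l1_ball G" for v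
    using l1_ballD(2)[OF cnv_eval_ball[OF assms(1)], of v t] that by (force simp: l1_norm_nonneg)
  then show ?case by blast
next
  case (CConn u \<phi>s)
  then have "\<forall>\<phi>\<in>set \<phi>s. \<exists>B. \<forall>v. range v \<subseteq> l1_ball G \<longrightarrow> \<bar>cnv_val G v \<phi>\<bar> \<le> B"
    by auto
  then obtain b where b: "\<And>\<phi> v. \<phi> \<in> set \<phi>s \<Longrightarrow> range v \<subseteq> l1_ball G \<Longrightarrow> \<bar>cnv_val G v \<phi>\<bar> \<le> b \<phi>"
    using bchoice by metis
  \<comment> \<open>One bound for all arguments at once; being a sum of absolute values, it is
    nonnegative and also covers the coordinates padded with 0.\<close>
  let ?B = "\<Sum>\<phi>\<in>set \<phi>s. \<bar>b \<phi>\<bar>"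
  obtain C where C: "\<And>x. (\<forall>i. \<bar>x i\<bar> \<le> ?B) \<Longrightarrow> \<bar>u x\<bar> \<le> C"
    using connective_bounded[of u ?B] CConn.prems by auto
  have "\<bar>cnv_val G v (CConn u \<phi>s)\<bar> \<le> C" if v: "range v \<subseteq> l1_ball G" for v
    unfolding cnv_val.simps
  proof (intro C allI)
    fix i
    have "\<bar>cnv_val G v (\<phi>s ! i)\<bar> \<le> ?B" if "i < length \<phi>s"
      using b[OF nth_mem[OF that] v] member_le_sum[of "\<phi>s ! i" "set \<phi>s" "\<lambda>\<phi>. \<bar>b \<phi>\<bar>"] that
      by force
    then show "\<bar>if i < length \<phi>s then map (cnv_val G v) \<phi>s ! i else 0\<bar> \<le> ?B"
      by (simp add: sum_nonneg)
  qed
  then show ?case by blast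
next
  case (CSup i \<phi>)
  then obtain B where B: "\<And>v. range v \<subseteq> l1_ball G \<Longrightarrow> \<bar>cnv_val G v \<phi>\<bar> \<le> B"
    by auto
  have "\<bar>cnv_val G v (CSup i \<phi>)\<bar> \<le> B" if "range v \<subseteq> l1_ball G" for v
    unfolding cnv_val.simps using that l1_ball_zero[of G]
    by (intro cSup_abs_le) (auto intro!: B split: if_splits)
  then show ?case by blast
next
  case (CInf i \<phi>)
  then obtain B where B: "\<And>v. range v \<subseteq> l1_ball G \<Longrightarrow> \<bar>cnv_val G v \<phi>\<bar> \<le> B"
    by auto
  have "\<bar>cnv_val G v (CInf i \<phi>)\<bar> \<le> B" if "range v \<subseteq> l1_ball G" for v
    unfolding cnv_val.simps using that l1_ball_zero[of G]
    by (intro cInf_abs_ge) (auto intro!: B split: if_splits)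
  then show ?case by blast
qed

text \<open>Atomic formulas inherit a modulus from the Lipschitz constants of terms, and connectives
  from compactness. A quantifier keeps the modulus of its body, since both assignments are updated
  by the same function.\<close>

lemma cnv_val_uniformly_continuous:
  fixes G :: "('a, 'm) monoid_scheme"
  assumes "group G" and "cnv_wf \<phi>" and "0 < \<epsilon>"
  shows "\<exists>\<delta>>0. \<forall>v w. range v \<subseteq> l1_ball G \<longrightarrow> range w \<subseteq> l1_ball G \<longrightarrow>
    (\<forall>i. l1_norm G (\<lambda>x. v i x - w i x) \<le> \<delta>) \<longrightarrow> \<bar>cnv_val G v \<phi> - cnv_val G w \<phi>\<bar> \<le> \<epsilon>"
  using assms(2,3)
proof (induction \<phi> arbitrary: \<epsilon>)
  case (CDist s t)
  obtain L where "L \<ge> 0" and L: "\<And>(v :: nat \<Rightarrow> 'a \<Rightarrow> real) w \<delta>. range v \<subseteq> l1_ball G \<Longrightarrow>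
      range w \<subseteq> l1_ball G \<Longrightarrow> (\<forall>i. l1_norm G (\<lambda>x. v i x - w i x) \<le> \<delta>) \<Longrightarrow>
      l1_norm G (\<lambda>x. cnv_eval G v s x - cnv_eval G w s x) \<le> L * \<delta>"
    using cnv_eval_Lipschitz[OF assms(1), of s] by blast
  obtain M where "M \<ge> 0" and M: "\<And>(v :: nat \<Rightarrow> 'a \<Rightarrow> real) w \<delta>. range v \<subseteq> l1_ball G \<Longrightarrow>
      range w \<subseteq> l1_ball G \<Longrightarrow> (\<forall>i. l1_norm G (\<lambda>x. v i x - w i x) \<le> \<delta>) \<Longrightarrow>
      l1_norm G (\<lambda>x. cnv_eval G v t x - cnv_eval G w t x) \<le> M * \<delta>"
    using cnv_eval_Lipschitz[OF assms(1), of t] by blast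
  \<comment> \<open>Adding 1 keeps the denominator positive when both Lipschitz constants
    vanish.\<close>
  define \<delta> where "\<delta> = \<epsilon> / (L + M + 1)"
  have "0 < \<delta>" "(L + M) * \<delta> \<le> \<epsilon>"
    using \<open>L \<ge> 0\<close> \<open>M \<ge> 0\<close> \<open>0 < \<epsilon>\<close> by (auto simp: \<delta>_def field_simps)
  moreover have "\<bar>cnv_val G v (CDist s t) - cnv_val G w (CDist s t)\<bar> \<le> (L + M) * \<delta>"
    if vw: "range v \<subseteq> l1_ball G" "range w \<subseteq> l1_ball G" "\<forall>i. l1_norm G (\<lambda>x. v i x - w i x) \<le> \<delta>"
    for v w
  proof -
    have l1: "cnv_eval G v u \<in> l1 G" "cnv_eval G w u \<in> l1 G" for u
      using cnv_eval_ball[OF assms(1)] vw(1,2) by (blast intro: l1_ballD(1))+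
    let ?D = "\<lambda>v x. cnv_eval G v s x - cnv_eval G v t x"
    have "\<bar>l1_norm G (?D v) - l1_norm G (?D w)\<bar> \<le> l1_norm G (\<lambda>x. ?D v x - ?D w x)"
      by (intro l1_norm_diff_norm l1_diff l1)
    also have "\<dots> \<le> 1 * (l1_norm G (\<lambda>x. cnv_eval G v s x - cnv_eval G w s x) +
        l1_norm G (\<lambda>x. cnv_eval G v t x - cnv_eval G w t x))"
      by (rule l1_dominated(2)) (auto intro: l1_diff l1 simp: l1[THEN l1_vanish])
    also have "\<dots> \<le> (L + M) * \<delta>"
      using L[OF vw] M[OF vw] by (simp add: distrib_right)
    finally show ?thesis
      by simp
  qed
  ultimately show ?case
    by (meson order_trans)
next
  case (CNorm t)
  obtain L where "L \<ge> 0" and L: "\<And>(v :: nat \<Rightarrow> 'a \<Rightarrow> real) w \<delta>. range v \<subseteq> l1_ball G \<Longrightarrow>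
      range w \<subseteq> l1_ball G \<Longrightarrow> (\<forall>i. l1_norm G (\<lambda>x. v i x - w i x) \<le> \<delta>) \<Longrightarrow>
      l1_norm G (\<lambda>x. cnv_eval G v t x - cnv_eval G w t x) \<le> L * \<delta>"
    using cnv_eval_Lipschitz[OF assms(1), of t] by blast
  define \<delta> where "\<delta> = \<epsilon> / (L + 1)"
  have "0 < \<delta>" "L * \<delta> \<le> \<epsilon>"
    using \<open>L \<ge> 0\<close> \<open>0 < \<epsilon>\<close> by (auto simp: \<delta>_def field_simps)
  moreover have "\<bar>cnv_val G v (CNorm t) - cnv_val G w (CNorm t)\<bar> \<le> L * \<delta>"
    if vw: "range v \<subseteq> l1_ball G" "range w \<subseteq> l1_ball G" "\<forall>i. l1_norm G (\<lambda>x. v i x - w i x) \<le> \<delta>"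
    for v w
  proof -
    have l1: "cnv_eval G v u \<in> l1 G" "cnv_eval G w u \<in> l1 G" for u
      using cnv_eval_ball[OF assms(1)] vw(1,2) by (blast intro: l1_ballD(1))+
    show ?thesis
      using l1_norm_diff_norm[OF l1(1,2)[of t]] L[OF vw] by simp
  qed
  ultimately show ?case
    by (meson order_trans)
next
  case (CConn u \<phi>s)
  have "\<forall>\<phi>\<in>set \<phi>s. \<exists>B. \<forall>v. range v \<subseteq> l1_ball G \<longrightarrow> \<bar>cnv_val G v \<phi>\<bar> \<le> B"
    using CConn.prems cnv_val_bounded[OF assms(1)] by simp
  then obtain b where b: "\<And>\<phi> v. \<phi> \<in> set \<phi>s \<Longrightarrow> range v \<subseteq> l1_ball G \<Longrightarrow> \<bar>cnv_val G v \<phi>\<bar> \<le> b \<phi>"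
    using bchoice by metis
  let ?B = "\<Sum>\<phi>\<in>set \<phi>s. \<bar>b \<phi>\<bar>"
  let ?x = "\<lambda>v i. if i < length \<phi>s then map (cnv_val G v) \<phi>s ! i else 0"
  have B: "\<bar>?x v i\<bar> \<le> ?B" if v: "range v \<subseteq> l1_ball G" for v i
  proof -
    have "\<bar>cnv_val G v (\<phi>s ! i)\<bar> \<le> ?B" if "i < length \<phi>s"
      using b[OF nth_mem[OF that] v] member_le_sum[of "\<phi>s ! i" "set \<phi>s" "\<lambda>\<phi>. \<bar>b \<phi>\<bar>"] that
      by force
    then show ?thesis
      by (simp add: sum_nonneg)
  qed
  obtain \<eta> where "\<eta> > 0" and \<eta>: "\<And>x y. \<forall>i. \<bar>x i\<bar> \<le> ?B \<Longrightarrow> \<forall>i. \<bar>y i\<bar> \<le> ?B \<Longrightarrow>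
      \<forall>i. \<bar>x i - y i\<bar> \<le> \<eta> \<Longrightarrow> \<bar>u x - u y\<bar> \<le> \<epsilon>"
    using connective_uniformly_continuous[of u \<epsilon> ?B] CConn.prems by auto
  have "\<forall>\<phi>\<in>set \<phi>s. \<exists>\<delta>>0. \<forall>v w. range v \<subseteq> l1_ball G \<longrightarrow> range w \<subseteq> l1_ball G \<longrightarrow>
    (\<forall>i. l1_norm G (\<lambda>x. v i x - w i x) \<le> \<delta>) \<longrightarrow> \<bar>cnv_val G v \<phi> - cnv_val G w \<phi>\<bar> \<le> \<eta>"
    using CConn.IH CConn.prems \<open>\<eta> > 0\<close> by simp
  from bchoice[OF this] obtain d where d: "\<forall>\<phi>\<in>set \<phi>s. d \<phi> > 0 \<and>
    (\<forall>v w. range v \<subseteq> l1_ball G \<longrightarrow> range w \<subseteq> l1_ball G \<longrightarrow>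
      (\<forall>i. l1_norm G (\<lambda>x. v i x - w i x) \<le> d \<phi>) \<longrightarrow> \<bar>cnv_val G v \<phi> - cnv_val G w \<phi>\<bar> \<le> \<eta>)"
    by blast
  \<comment> \<open>The element 1 keeps the set nonempty for a connective without arguments.\<close>
  define \<delta> where "\<delta> = Min (insert 1 (d ` set \<phi>s))"
  have "\<delta> > 0"
    using d by (simp add: \<delta>_def)
  have \<delta>: "\<delta> \<le> d \<phi>" if "\<phi> \<in> set \<phi>s" for \<phi>
    using that by (simp add: \<delta>_def)
  have "\<bar>cnv_val G v (CConn u \<phi>s) - cnv_val G w (CConn u \<phi>s)\<bar> \<le> \<epsilon>"
    if vw: "range v \<subseteq> l1_ball G" "range w \<subseteq> l1_ball G" "\<forall>i. l1_norm G (\<lambda>x. v i x - w i x) \<le> \<delta>"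
    for v w
    unfolding cnv_val.simps
  proof (intro \<eta> allI B vw(1,2))
    fix i
    have "\<bar>cnv_val G v (\<phi>s ! i) - cnv_val G w (\<phi>s ! i)\<bar> \<le> \<eta>" if "i < length \<phi>s"
      using d nth_mem[OF that] vw order_trans[OF _ \<delta>[OF nth_mem[OF that]]] by blast
    then show "\<bar>?x v i - ?x w i\<bar> \<le> \<eta>"
      using \<open>\<eta> > 0\<close> by simp
  qed
  then show ?case
    using \<open>\<delta> > 0\<close> by blast
next
  have quant: "\<exists>\<delta>>0. \<forall>v w. range v \<subseteq> l1_ball G \<longrightarrow> range w \<subseteq> l1_ball G \<longrightarrow>
      (\<forall>i. l1_norm G (\<lambda>x. v i x - w i x) \<le> \<delta>) \<longrightarrow>
      \<bar>cnv_val G v (CSup i \<phi>) - cnv_val G w (CSup i \<phi>)\<bar> \<le> \<epsilon> \<and>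
      \<bar>cnv_val G v (CInf i \<phi>) - cnv_val G w (CInf i \<phi>)\<bar> \<le> \<epsilon>"
    if IH: "\<exists>\<delta>>0. \<forall>v w. range v \<subseteq> l1_ball G \<longrightarrow> range w \<subseteq> l1_ball G \<longrightarrow>
      (\<forall>i. l1_norm G (\<lambda>x. v i x - w i x) \<le> \<delta>) \<longrightarrow> \<bar>cnv_val G v \<phi> - cnv_val G w \<phi>\<bar> \<le> \<epsilon>"
    and "cnv_wf \<phi>" for i \<phi> \<epsilon>
  proof -
    from IH obtain \<delta> where "\<delta> > 0" and \<delta>: "\<And>v w. range v \<subseteq> l1_ball G \<Longrightarrow> range w \<subseteq> l1_ball G \<Longrightarrow>
      (\<forall>i. l1_norm G (\<lambda>x. v i x - w i x) \<le> \<delta>) \<Longrightarrow> \<bar>cnv_val G v \<phi> - cnv_val G w \<phi>\<bar> \<le> \<epsilon>"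
      by blast
    obtain B where B: "\<And>v. range v \<subseteq> l1_ball G \<Longrightarrow> \<bar>cnv_val G v \<phi>\<bar> \<le> B"
      using cnv_val_bounded[OF assms(1) \<open>cnv_wf \<phi>\<close>] by blast
    have "\<bar>cnv_val G v (CSup i \<phi>) - cnv_val G w (CSup i \<phi>)\<bar> \<le> \<epsilon> \<and>
      \<bar>cnv_val G v (CInf i \<phi>) - cnv_val G w (CInf i \<phi>)\<bar> \<le> \<epsilon>"
      if vw: "range v \<subseteq> l1_ball G" "range w \<subseteq> l1_ball G" "\<forall>i. l1_norm G (\<lambda>x. v i x - w i x) \<le> \<delta>"
      for v w
    proof -
      have upd: "range (v(i := f)) \<subseteq> l1_ball G" "range (w(i := f)) \<subseteq> l1_ball G"
        if "f \<in> l1_ball G" for f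
        using vw(1,2) that by (auto split: if_splits)
      \<comment> \<open>At index \<open>i\<close> the updated assignments coincide, so their
        distance there is 0; elsewhere it is unchanged.\<close>
      have "\<bar>cnv_val G (v(i := f)) \<phi> - cnv_val G (w(i := f)) \<phi>\<bar> \<le> \<epsilon>" if "f \<in> l1_ball G" for f
        using vw(3) \<open>\<delta> > 0\<close> by (intro \<delta> upd that) (auto simp: l1_norm_zero)
      moreover have "l1_ball G \<noteq> {}"
        using l1_ball_zero by blast
      ultimately show ?thesis
        unfolding cnv_val.simps by (intro conjI cSUP_cINF_close[where K = B and L = B]) (auto intro!: B upd)
    qed
    then show ?thesis
      using \<open>\<delta> > 0\<close> by blast
  qed
  {
    case (CSup i \<phi>)
    then show ?case
      using quant[of \<phi> \<epsilon> i] by auto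
  next
    case (CInf i \<phi>)
    then show ?case
      using quant[of \<phi> \<epsilon> i] by auto
  }
qed

section \<open>Matching functions along a back-and-forth system\<close>

lemma back_forth_extend:
  assumes "back_forth G H P" and "p \<in> P" and "finite A" and "A \<subseteq> carrier G"
  shows "\<exists>q\<in>P. p \<subseteq> q \<and> A \<subseteq> Domain q"
  using assms(3,4)
proof (induction A rule: finite_induct)
  case empty
  then show ?case using assms(2) by auto
next
  case (insert a A)
  then obtain q where q: "q \<in> P" "p \<subseteq> q" "A \<subseteq> Domain q" by auto
  with insert.prems obtain b where "insert (a, b) q \<in> P"
    using back_forthD(5)[OF assms(1)] by blast
  then show ?case
    using q by (intro bexI[of _ "insert (a, b) q"]) auto
qed

definition l1_match :: "('a \<times> 'b) set \<Rightarrow> ('a \<Rightarrow> real) \<Rightarrow> ('b \<Rightarrow> real) \<Rightarrow> bool" where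
  "l1_match p f g \<longleftrightarrow> (\<forall>x. f x \<noteq> 0 \<longrightarrow> x \<in> Domain p) \<and> (\<forall>y. g y \<noteq> 0 \<longrightarrow> y \<in> Range p) \<and>
     (\<forall>x y. (x, y) \<in> p \<longrightarrow> f x = g y)"

lemma l1_match_converse: "l1_match p f g \<Longrightarrow> l1_match (converse p) g f"
  by (auto simp: l1_match_def)

text \<open>Since \<open>q\<close> is injective and single-valued, a pair of \<open>q\<close> that
  meets the domain or the range of \<open>p\<close> already lies in \<open>p\<close>. At all new
  pairs both functions vanish.\<close>

lemma l1_match_mono:
  assumes "back_forth G H P" and "q \<in> P" and "p \<subseteq> q" and match: "l1_match p f g"
  shows "l1_match q f g"
proof -
  have "f x = g y" if "(x, y) \<in> q" for x y
  proof (cases "f x = 0 \<and> g y = 0")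
    case False
    then have "x \<in> Domain p \<or> y \<in> Range p"
      using match by (auto simp: l1_match_def)
    then have "(x, y) \<in> p"
      using back_forthD(3)[OF assms(1,2) that] assms(3) by blast
    then show ?thesis
      using match by (auto simp: l1_match_def)
  qed simp
  moreover have "f x \<noteq> 0 \<Longrightarrow> x \<in> Domain q" "g y \<noteq> 0 \<Longrightarrow> y \<in> Range q" for x y
    using match Domain_mono[OF assms(3)] Range_mono[OF assms(3)] unfolding l1_match_def by blast+
  ultimately show ?thesis
    unfolding l1_match_def by blast
qed

lemma l1_match_pointwise:
  assumes "l1_match p f g" and "l1_match p f' g'" and "h 0 0 = 0"
  shows "l1_match p (\<lambda>x. h (f x) (f' x)) (\<lambda>y. h (g y) (g' y))"
proof -
  have "f x \<noteq> 0 \<or> f' x \<noteq> 0" if "h (f x) (f' x) \<noteq> 0" for x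
    using that assms(3) by auto
  moreover have "g y \<noteq> 0 \<or> g' y \<noteq> 0" if "h (g y) (g' y) \<noteq> 0" for y
    using that assms(3) by auto
  moreover have "h (f x) (f' x) = h (g y) (g' y)" if "(x, y) \<in> p" for x y
    using that assms(1,2) by (simp add: l1_match_def)
  ultimately show ?thesis
    using assms(1,2) unfolding l1_match_def by blast
qed

lemma back_forth_inj_on:
  assumes "back_forth G H P" and "p \<in> P"
  shows "inj_on fst p" and "inj_on snd p"
  using back_forthD(3)[OF assms] by (auto simp: inj_on_def)

lemma l1_norm_finite_support:
  assumes "finite A" and "A \<subseteq> carrier G" and "{x. f x \<noteq> 0} \<subseteq> A"
  shows "l1_norm G f = (\<Sum>x\<in>A. \<bar>f x\<bar>)"
proof -
  have "l1_norm G f = (\<Sum>\<^sub>\<infinity>x\<in>A. \<bar>f x\<bar>)"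
    unfolding l1_norm_def by (rule infsum_cong_neutral) (use assms in auto)
  then show ?thesis
    using assms(1) by simp
qed

lemma l1_finite_support:
  assumes "finite A" and "A \<subseteq> carrier G" and "{x. f x \<noteq> 0} \<subseteq> A"
  shows "f \<in> l1 G"
proof -
  have "(\<lambda>x. \<bar>f x\<bar>) summable_on A"
    using assms(1) by simp
  then have "(\<lambda>x. \<bar>f x\<bar>) summable_on carrier G"
    by (rule summable_on_cong_neutral[THEN iffD1, rotated -1]) (use assms in auto)
  then show ?thesis
    using assms(2,3) by (auto simp: l1_def)
qed

text \<open>Both norms are finite sums, and both projections of \<open>p\<close> are injective, so
  each can be rewritten as a sum over the pairs in \<open>p\<close>.\<close>

lemma l1_match_norm:
  assumes "back_forth G H P" and "p \<in> P" and match: "l1_match p f g"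
  shows "l1_norm G f = l1_norm H g"
proof -
  note p = back_forthD[OF assms(1,2)] and inj = back_forth_inj_on[OF assms(1,2)]
  have "l1_norm G f = (\<Sum>x\<in>fst ` p. \<bar>f x\<bar>)"
    using p(1,2) match by (intro l1_norm_finite_support) (auto simp: l1_match_def Domain_fst)
  also have "\<dots> = (\<Sum>z\<in>p. \<bar>f (fst z)\<bar>)"
    by (simp add: sum.reindex[OF inj(1)])
  also have "\<dots> = (\<Sum>z\<in>p. \<bar>g (snd z)\<bar>)"
    using match by (intro sum.cong) (auto simp: l1_match_def)
  also have "\<dots> = (\<Sum>y\<in>snd ` p. \<bar>g y\<bar>)"
    by (simp add: sum.reindex[OF inj(2)])
  also have "\<dots> = l1_norm H g"
    using p(1,2) match by (intro l1_norm_finite_support[symmetric]) (auto simp: l1_match_def Range_snd)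
  finally show ?thesis .
qed

section \<open>Convolution of finitely supported functions and values of terms\<close>

lemma conv_finite_support:
  assumes "group G" and "finite A" and "A \<subseteq> carrier G"
    and f: "{x. f x \<noteq> 0} \<subseteq> A" and g: "{x. g x \<noteq> 0} \<subseteq> A" and z: "z \<in> carrier G"
  shows "conv G f g z = (\<Sum>x\<in>A. \<Sum>y\<in>A. if x \<otimes>\<^bsub>G\<^esub> y = z then f x * g y else 0)"
proof -
  interpret group G by fact
  have "conv G f g z = (\<Sum>\<^sub>\<infinity>x\<in>A. f x * g (inv\<^bsub>G\<^esub> x \<otimes>\<^bsub>G\<^esub> z))"
    unfolding conv_def using z by simp (rule infsum_cong_neutral, use assms in auto)
  also have "\<dots> = (\<Sum>x\<in>A. f x * g (inv\<^bsub>G\<^esub> x \<otimes>\<^bsub>G\<^esub> z))"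
    using assms(2) by simp
  also have "\<dots> = (\<Sum>x\<in>A. \<Sum>y\<in>A. if x \<otimes>\<^bsub>G\<^esub> y = z then f x * g y else 0)"
  proof (rule sum.cong[OF refl])
    fix x assume x: "x \<in> A"
    have "(\<Sum>y\<in>A. if x \<otimes>\<^bsub>G\<^esub> y = z then f x * g y else 0) =
        (\<Sum>y\<in>A. if y = inv\<^bsub>G\<^esub> x \<otimes>\<^bsub>G\<^esub> z then f x * g y else 0)"
    proof (rule sum.cong[OF refl])
      fix y assume "y \<in> A"
      then have "x \<in> carrier G" "y \<in> carrier G"
        using x assms(3) by auto
      then have "x \<otimes>\<^bsub>G\<^esub> y = z \<longleftrightarrow> y = inv\<^bsub>G\<^esub> x \<otimes>\<^bsub>G\<^esub> z"
        using inv_solve_left[of y x z] z by auto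
      then show "(if x \<otimes>\<^bsub>G\<^esub> y = z then f x * g y else 0) =
        (if y = inv\<^bsub>G\<^esub> x \<otimes>\<^bsub>G\<^esub> z then f x * g y else 0)"
        by simp
    qed
    \<comment> \<open>If the unique solution lies outside \<open>A\<close>, the sum is 0, and so is
      the right-hand side because \<open>g\<close> vanishes there.\<close>
    also have "\<dots> = f x * g (inv\<^bsub>G\<^esub> x \<otimes>\<^bsub>G\<^esub> z)"
      using assms(2) g by (auto simp: sum.delta)
    finally show "f x * g (inv\<^bsub>G\<^esub> x \<otimes>\<^bsub>G\<^esub> z) = (\<Sum>y\<in>A. if x \<otimes>\<^bsub>G\<^esub> y = z then f x * g y else 0)"
      by simp
  qed
  finally show ?thesis .
qed

lemma conv_finite_support_nonzero:
  assumes "group G" and "finite A" and "A \<subseteq> carrier G"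
    and "{x. f x \<noteq> 0} \<subseteq> A" and "{x. g x \<noteq> 0} \<subseteq> A" and nz: "conv G f g z \<noteq> 0"
  shows "z \<in> (\<lambda>(x, y). x \<otimes>\<^bsub>G\<^esub> y) ` (A \<times> A)"
proof (rule ccontr)
  assume *: "z \<notin> (\<lambda>(x, y). x \<otimes>\<^bsub>G\<^esub> y) ` (A \<times> A)"
  have "z \<in> carrier G"
    using nz by (auto simp: conv_def split: if_splits)
  have "conv G f g z = (\<Sum>x\<in>A. \<Sum>y\<in>A. 0)"
    unfolding conv_finite_support[OF assms(1-5) \<open>z \<in> carrier G\<close>]
    by (intro sum.cong refl) (use * in force)
  then show False
    using nz by simp
qed

text \<open>The support of a convolution consists of products, so \<open>p\<close> is extended to
  the products of elements of its domain. The two double sums then agree term by term, since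
  \<open>q\<close> respects multiplication.\<close>

lemma l1_match_conv:
  assumes "group G" and "group H" and bf: "back_forth G H P" and "p \<in> P"
    and f: "l1_match p f f'" and g: "l1_match p g g'"
  shows "\<exists>q\<in>P. p \<subseteq> q \<and> l1_match q (conv G f g) (conv H f' g')"
proof -
  note p = back_forthD[OF bf \<open>p \<in> P\<close>] and inj = back_forth_inj_on[OF bf \<open>p \<in> P\<close>]
  let ?A = "fst ` p" and ?B = "snd ` p"
  have A: "finite ?A" "?A \<subseteq> carrier G" "{x. f x \<noteq> 0} \<subseteq> ?A" "{x. g x \<noteq> 0} \<subseteq> ?A"
    using p(1,2) f g by (auto simp: l1_match_def Domain_fst)
  have B: "finite ?B" "?B \<subseteq> carrier H" "{x. f' x \<noteq> 0} \<subseteq> ?B" "{x. g' x \<noteq> 0} \<subseteq> ?B"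
    using p(1,2) f g by (auto simp: l1_match_def Range_snd)
  interpret G: group G by fact
  have "(\<lambda>(x, y). x \<otimes>\<^bsub>G\<^esub> y) ` (?A \<times> ?A) \<subseteq> carrier G"
    using A(2) by auto
  then obtain q where q: "q \<in> P" "p \<subseteq> q" "(\<lambda>(x, y). x \<otimes>\<^bsub>G\<^esub> y) ` (?A \<times> ?A) \<subseteq> Domain q"
    using back_forth_extend[OF bf \<open>p \<in> P\<close>, of "(\<lambda>(x, y). x \<otimes>\<^bsub>G\<^esub> y) ` (?A \<times> ?A)"] A(1) by auto
  have "x \<in> Domain q" if nz: "conv G f g x \<noteq> 0" for x
    using conv_finite_support_nonzero[OF \<open>group G\<close> A nz] q(3) by blast
  moreover have "y \<in> Range q" if nz: "conv H f' g' y \<noteq> 0" for y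
  proof -
    obtain y1 y2 where y: "y1 \<in> ?B" "y2 \<in> ?B" "y = y1 \<otimes>\<^bsub>H\<^esub> y2"
      using conv_finite_support_nonzero[OF \<open>group H\<close> B nz] by auto
    then obtain x1 x2 where x: "(x1, y1) \<in> p" "(x2, y2) \<in> p"
      by auto
    then have "(x1, x2) \<in> ?A \<times> ?A"
      by force
    then have "x1 \<otimes>\<^bsub>G\<^esub> x2 \<in> Domain q"
      using q(3) by auto
    then obtain y' where "(x1 \<otimes>\<^bsub>G\<^esub> x2, y') \<in> q"
      by blast
    then have "(x1 \<otimes>\<^bsub>G\<^esub> x2, y) \<in> q"
      using back_forthD(4)[OF bf q(1), of x1 y1 x2 y2 "x1 \<otimes>\<^bsub>G\<^esub> x2" y'] x q(2) y(3) by auto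
    then show ?thesis
      by blast
  qed
  moreover have "conv G f g x = conv H f' g' y" if xy: "(x, y) \<in> q" for x y
  proof -
    have "x \<in> carrier G" "y \<in> carrier H"
      using back_forthD(2)[OF bf q(1)] xy by auto
    have "conv G f g x = (\<Sum>a\<in>p. \<Sum>b\<in>p. if fst a \<otimes>\<^bsub>G\<^esub> fst b = x then f (fst a) * g (fst b) else 0)"
      using conv_finite_support[OF \<open>group G\<close> A \<open>x \<in> carrier G\<close>]
      by (simp add: sum.reindex[OF inj(1)])
    also have "\<dots> = (\<Sum>a\<in>p. \<Sum>b\<in>p. if snd a \<otimes>\<^bsub>H\<^esub> snd b = y then f' (snd a) * g' (snd b) else 0)"
    proof (intro sum.cong refl)
      fix a b assume ab: "a \<in> p" "b \<in> p"
      then have "fst a \<otimes>\<^bsub>G\<^esub> fst b = x \<longleftrightarrow> snd a \<otimes>\<^bsub>H\<^esub> snd b = y"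
        using back_forthD(4)[OF bf q(1), of "fst a" "snd a" "fst b" "snd b" x y] q(2) xy by auto
      moreover have "f (fst a) = f' (snd a)" "g (fst b) = g' (snd b)"
        using f g ab by (auto simp: l1_match_def)
      ultimately show "(if fst a \<otimes>\<^bsub>G\<^esub> fst b = x then f (fst a) * g (fst b) else 0) =
          (if snd a \<otimes>\<^bsub>H\<^esub> snd b = y then f' (snd a) * g' (snd b) else 0)"
        by simp
    qed
    also have "\<dots> = conv H f' g' y"
      using conv_finite_support[OF \<open>group H\<close> B \<open>y \<in> carrier H\<close>]
      by (simp add: sum.reindex[OF inj(2)])
    finally show ?thesis .
  qed
  ultimately have "l1_match q (conv G f g) (conv H f' g')"
    by (auto simp: l1_match_def)
  then show ?thesis
    using q by blast
qed

text \<open>The map varies in the induction: the second subterm starts from the extension found for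
  the first, and the earlier match survives by \<open>l1_match_mono\<close>.\<close>

lemma cnv_eval_match:
  assumes "group G" and "group H" and bf: "back_forth G H P"
  shows "p \<in> P \<Longrightarrow> (\<forall>i. l1_match p (v i) (w i)) \<Longrightarrow>
    \<exists>q\<in>P. p \<subseteq> q \<and> l1_match q (cnv_eval G v t) (cnv_eval H w t)"
proof (induction t arbitrary: p)
  case (CVar i)
  then show ?case by auto
next
  case CZero
  then show ?case by (auto simp: l1_match_def)
next
  have two: "\<exists>q\<in>P. p \<subseteq> q \<and> l1_match q (cnv_eval G v s) (cnv_eval H w s) \<and>
      l1_match q (cnv_eval G v t) (cnv_eval H w t)"
    if s: "\<And>p. p \<in> P \<Longrightarrow> (\<forall>i. l1_match p (v i) (w i)) \<Longrightarrow>
        \<exists>q\<in>P. p \<subseteq> q \<and> l1_match q (cnv_eval G v s) (cnv_eval H w s)"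
      and t: "\<And>p. p \<in> P \<Longrightarrow> (\<forall>i. l1_match p (v i) (w i)) \<Longrightarrow>
        \<exists>q\<in>P. p \<subseteq> q \<and> l1_match q (cnv_eval G v t) (cnv_eval H w t)"
      and p: "p \<in> P" "\<forall>i. l1_match p (v i) (w i)" for s t p
  proof -
    obtain q where q: "q \<in> P" "p \<subseteq> q" "l1_match q (cnv_eval G v s) (cnv_eval H w s)"
      using s[OF p] by blast
    moreover obtain r where r: "r \<in> P" "q \<subseteq> r" "l1_match r (cnv_eval G v t) (cnv_eval H w t)"
      using t[OF q(1)] l1_match_mono[OF bf q(1,2)] p(2) by blast
    ultimately show ?thesis
      using l1_match_mono[OF bf r(1,2)] by blast
  qed
  {
    case (CPlus s t)
    obtain q where q: "q \<in> P" "p \<subseteq> q" "l1_match q (cnv_eval G v s) (cnv_eval H w s)"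
        "l1_match q (cnv_eval G v t) (cnv_eval H w t)"
      using two[OF CPlus] by blast
    then show ?case
      using l1_match_pointwise[OF q(3,4), of "\<lambda>a b. (a + b) / 2"] by auto
  next
    case (CMeet s t)
    obtain q where q: "q \<in> P" "p \<subseteq> q" "l1_match q (cnv_eval G v s) (cnv_eval H w s)"
        "l1_match q (cnv_eval G v t) (cnv_eval H w t)"
      using two[OF CMeet] by blast
    then show ?case
      using l1_match_pointwise[OF q(3,4), of "\<lambda>a b. min a b / 2"] by auto
  next
    case (CJoin s t)
    obtain q where q: "q \<in> P" "p \<subseteq> q" "l1_match q (cnv_eval G v s) (cnv_eval H w s)"
        "l1_match q (cnv_eval G v t) (cnv_eval H w t)"
      using two[OF CJoin] by blast
    then show ?case
      using l1_match_pointwise[OF q(3,4), of "\<lambda>a b. max a b / 2"] by auto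
  next
    case (CConv s t)
    obtain q where q: "q \<in> P" "p \<subseteq> q" "l1_match q (cnv_eval G v s) (cnv_eval H w s)"
        "l1_match q (cnv_eval G v t) (cnv_eval H w t)"
      using two[OF CConv] by blast
    then show ?case
      using l1_match_conv[OF assms q(1,3,4)] by auto
  }
qed

section \<open>Transfer of the values of formulas\<close>

text \<open>Once \<open>p\<close> is extended to the support of \<open>f\<close>, the partner is the
  transport of \<open>f\<close> along \<open>q\<close>; equality of norms puts it in the
  ball.\<close>

lemma l1_match_exists:
  assumes bf: "back_forth G H P" and "p \<in> P" and f: "f \<in> l1_ball G" "finite {x. f x \<noteq> 0}"
  shows "\<exists>q\<in>P. \<exists>g\<in>l1_ball H. p \<subseteq> q \<and> l1_match q f g"
proof -
  have "{x. f x \<noteq> 0} \<subseteq> carrier G"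
    using l1_vanish[OF l1_ballD(1)[OF f(1)]] by auto
  then obtain q where q: "q \<in> P" "p \<subseteq> q" "{x. f x \<noteq> 0} \<subseteq> Domain q"
    using back_forth_extend[OF bf \<open>p \<in> P\<close> f(2)] by blast
  \<comment> \<open>The description is proper on the range of \<open>q\<close>, since each
    \<open>y\<close> there has exactly one partner.\<close>
  define g where "g y = (if y \<in> Range q then f (THE x. (x, y) \<in> q) else 0)" for y
  have g: "g y = f x" if "(x, y) \<in> q" for x y
  proof -
    have "(THE x. (x, y) \<in> q) = x"
      using that back_forthD(3)[OF bf q(1)] by blast
    then show ?thesis
      using that by (auto simp: g_def)
  qed
  have "g y \<noteq> 0 \<Longrightarrow> y \<in> Range q" for y
    by (simp add: g_def split: if_splits)
  then have match: "l1_match q f g"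
    using q(3) g unfolding l1_match_def by auto
  have "g \<in> l1 H"
    by (rule l1_finite_support[of "Range q"])
      (use back_forthD(1,2)[OF bf q(1)] in \<open>auto simp: g_def finite_Range\<close>)
  then have "g \<in> l1_ball H"
    using l1_match_norm[OF bf q(1) match] l1_ballD(2)[OF f(1)] by (simp add: l1_ball_def)
  then show ?thesis
    using q match by blast
qed

text \<open>A function of infinite support has no partner along a finite map, so \<open>f\<close> is
  first replaced by a finitely supported \<open>f'\<close>. Only this replacement costs \<epsilon>,
  by uniform continuity in \<open>G\<close>; passing from \<open>f'\<close> to \<open>g\<close> is
  exact.\<close>

lemma cnv_val_forth:
  fixes G :: "('a, 'm) monoid_scheme" and H :: "('b, 'n) monoid_scheme"
  assumes "group G" and bf: "back_forth G H P" and "cnv_wf \<phi>"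
    and IH: "\<And>p v w. p \<in> P \<Longrightarrow> range v \<subseteq> l1_ball G \<Longrightarrow> range w \<subseteq> l1_ball H \<Longrightarrow>
      (\<forall>i. l1_match p (v i) (w i)) \<Longrightarrow> cnv_val G v \<phi> = cnv_val H w \<phi>"
    and "p \<in> P" and vw: "range v \<subseteq> l1_ball G" "range w \<subseteq> l1_ball H" "\<forall>i. l1_match p (v i) (w i)"
    and f: "f \<in> l1_ball G" and "0 < \<epsilon>"
  shows "\<exists>g\<in>l1_ball H. \<bar>cnv_val G (v(i := f)) \<phi> - cnv_val H (w(i := g)) \<phi>\<bar> \<le> \<epsilon>"
proof -
  obtain \<delta> where "\<delta> > 0" and \<delta>: "\<And>v w. range v \<subseteq> l1_ball G \<Longrightarrow> range w \<subseteq> l1_ball G \<Longrightarrow>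
      (\<forall>i. l1_norm G (\<lambda>x. v i x - w i x) \<le> \<delta>) \<Longrightarrow> \<bar>cnv_val G v \<phi> - cnv_val G w \<phi>\<bar> \<le> \<epsilon>"
    using cnv_val_uniformly_continuous[OF assms(1,3) \<open>0 < \<epsilon>\<close>] by blast
  obtain f' where f': "f' \<in> l1_ball G" "finite {x. f' x \<noteq> 0}" "l1_norm G (\<lambda>x. f x - f' x) \<le> \<delta>"
    using l1_ball_finite_support_approx[OF f \<open>\<delta> > 0\<close>] by blast
  obtain q g where q: "q \<in> P" "p \<subseteq> q" and g: "g \<in> l1_ball H" "l1_match q f' g"
    using l1_match_exists[OF bf \<open>p \<in> P\<close> f'(1,2)] by blast
  have ranges: "range (v(i := f)) \<subseteq> l1_ball G" "range (v(i := f')) \<subseteq> l1_ball G"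
      "range (w(i := g)) \<subseteq> l1_ball H"
    using vw(1,2) f f'(1) g(1) by (auto split: if_splits)
  have "\<bar>cnv_val G (v(i := f)) \<phi> - cnv_val G (v(i := f')) \<phi>\<bar> \<le> \<epsilon>"
    using f'(3) \<open>\<delta> > 0\<close> by (intro \<delta> ranges) (simp add: l1_norm_zero)
  moreover have "cnv_val G (v(i := f')) \<phi> = cnv_val H (w(i := g)) \<phi>"
    \<comment> \<open>The hypothesis is applied at the extension \<open>q\<close>, along which the
      old assignments still match.\<close>
    by (rule IH[OF q(1) ranges(2,3)]) (use g(2) l1_match_mono[OF bf q] vw(3) in simp)
  ultimately show ?thesis
    using g(1) by auto
qed

text \<open>Approximate partners in both directions bring the suprema, and likewise the infima,
  within every \<epsilon> of each other, so they are equal.\<close>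

lemma cnv_val_quantifier_match:
  fixes G :: "('a, 'm) monoid_scheme" and H :: "('b, 'n) monoid_scheme"
  assumes "group G" and "group H" and bf: "back_forth G H P" and "cnv_wf \<phi>"
    and IH: "\<And>p v w. p \<in> P \<Longrightarrow> range v \<subseteq> l1_ball G \<Longrightarrow> range w \<subseteq> l1_ball H \<Longrightarrow>
      (\<forall>i. l1_match p (v i) (w i)) \<Longrightarrow> cnv_val G v \<phi> = cnv_val H w \<phi>"
    and "p \<in> P" and vw: "range v \<subseteq> l1_ball G" "range w \<subseteq> l1_ball H" "\<forall>i. l1_match p (v i) (w i)"
  shows "cnv_val G v (CSup i \<phi>) = cnv_val H w (CSup i \<phi>)"
    and "cnv_val G v (CInf i \<phi>) = cnv_val H w (CInf i \<phi>)"
proof -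
  obtain K where K: "\<And>v. range v \<subseteq> l1_ball G \<Longrightarrow> \<bar>cnv_val G v \<phi>\<bar> \<le> K"
    using cnv_val_bounded[OF assms(1,4)] by blast
  obtain L where L: "\<And>v. range v \<subseteq> l1_ball H \<Longrightarrow> \<bar>cnv_val H v \<phi>\<bar> \<le> L"
    using cnv_val_bounded[OF assms(2,4)] by blast
  have close: "\<bar>cnv_val G v (CSup i \<phi>) - cnv_val H w (CSup i \<phi>)\<bar> \<le> \<epsilon> \<and>
      \<bar>cnv_val G v (CInf i \<phi>) - cnv_val H w (CInf i \<phi>)\<bar> \<le> \<epsilon>" if "0 < \<epsilon>" for \<epsilon>
  proof -
    have ne: "l1_ball G \<noteq> {}" "l1_ball H \<noteq> {}"
      using l1_ball_zero by blast+
    have K': "\<bar>cnv_val G (v(i := f)) \<phi>\<bar> \<le> K" if "f \<in> l1_ball G" for f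
      using vw(1) that by (intro K) (auto split: if_splits)
    have L': "\<bar>cnv_val H (w(i := g)) \<phi>\<bar> \<le> L" if "g \<in> l1_ball H" for g
      using vw(2) that by (intro L) (auto split: if_splits)
    have forth: "\<exists>g\<in>l1_ball H. \<bar>cnv_val G (v(i := f)) \<phi> - cnv_val H (w(i := g)) \<phi>\<bar> \<le> \<epsilon>"
      if "f \<in> l1_ball G" for f
      by (rule cnv_val_forth[OF assms(1) bf \<open>cnv_wf \<phi>\<close> IH \<open>p \<in> P\<close> vw that \<open>0 < \<epsilon>\<close>])
    \<comment> \<open>This is the forth step for the converse system, with the two groups
      exchanged.\<close>
    have backward: "\<exists>f\<in>l1_ball G. \<bar>cnv_val G (v(i := f)) \<phi> - cnv_val H (w(i := g)) \<phi>\<bar> \<le> \<epsilon>"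
      if "g \<in> l1_ball H" for g
    proof -
      have IH': "cnv_val H v' \<phi> = cnv_val G w' \<phi>"
        if "q \<in> converse ` P" "range v' \<subseteq> l1_ball H" "range w' \<subseteq> l1_ball G"
          "\<forall>i. l1_match q (v' i) (w' i)" for q v' w'
      proof -
        have "converse q \<in> P"
          using that(1) by auto
        then show ?thesis
          using IH[of "converse q" w' v'] that(2-4) l1_match_converse by metis
      qed
      have converse: "\<forall>i. l1_match (converse p) (w i) (v i)"
        using vw(3) l1_match_converse by blast
      have "\<exists>f\<in>l1_ball G. \<bar>cnv_val H (w(i := g)) \<phi> - cnv_val G (v(i := f)) \<phi>\<bar> \<le> \<epsilon>"
        by (rule cnv_val_forth[OF assms(2) back_forth_converse[OF bf] \<open>cnv_wf \<phi>\<close> IH'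
              imageI[OF \<open>p \<in> P\<close>] vw(2,1) converse that \<open>0 < \<epsilon>\<close>])
      then show ?thesis
        by (simp add: abs_minus_commute)
    qed
    show ?thesis
      unfolding cnv_val.simps using cSUP_cINF_close[OF ne K' L' forth backward] by blast
  qed
  then show "cnv_val G v (CSup i \<phi>) = cnv_val H w (CSup i \<phi>)"
    and "cnv_val G v (CInf i \<phi>) = cnv_val H w (CInf i \<phi>)"
    using dense_eq0_I[of "cnv_val G v (CSup i \<phi>) - cnv_val H w (CSup i \<phi>)"]
      dense_eq0_I[of "cnv_val G v (CInf i \<phi>) - cnv_val H w (CInf i \<phi>)"] by auto
qed

lemma cnv_val_match:
  assumes "group G" and "group H" and bf: "back_forth G H P" and "cnv_wf \<phi>" and "p \<in> P"
    and "range v \<subseteq> l1_ball G" and "range w \<subseteq> l1_ball H" and "\<forall>i. l1_match p (v i) (w i)"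
  shows "cnv_val G v \<phi> = cnv_val H w \<phi>"
  using assms(4-)
proof (induction \<phi> arbitrary: p v w)
  case (CDist s t)
  obtain q where q: "q \<in> P" "p \<subseteq> q" "l1_match q (cnv_eval G v s) (cnv_eval H w s)"
    using cnv_eval_match[OF assms(1-3) CDist.prems(2,5)] by blast
  \<comment> \<open>A second extension serves \<open>t\<close>; along it the difference of the two
    terms matches as well, so both distances are norms of matching functions.\<close>
  obtain r where r: "r \<in> P" "q \<subseteq> r" "l1_match r (cnv_eval G v t) (cnv_eval H w t)"
    using cnv_eval_match[OF assms(1-3) q(1)] l1_match_mono[OF bf q(1,2)] CDist.prems(5) by blast
  have "l1_match r (\<lambda>x. cnv_eval G v s x - cnv_eval G v t x) (\<lambda>x. cnv_eval H w s x - cnv_eval H w t x)"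
    by (rule l1_match_pointwise[OF l1_match_mono[OF bf r(1,2) q(3)] r(3)]) simp
  then show ?case
    using l1_match_norm[OF bf r(1)] by simp
next
  case (CNorm t)
  obtain q where "q \<in> P" "l1_match q (cnv_eval G v t) (cnv_eval H w t)"
    using cnv_eval_match[OF assms(1-3) CNorm.prems(2,5)] by blast
  then show ?case
    using l1_match_norm[OF bf] by simp
next
  case (CConn u \<phi>s)
  have "map (cnv_val G v) \<phi>s = map (cnv_val H w) \<phi>s"
    using CConn by (intro map_cong refl) auto
  then show ?case
    by (simp only: cnv_val.simps)
next
  case (CSup i \<phi>)
  then show ?case
    by (intro cnv_val_quantifier_match[OF assms(1-3)]) simp_all
next
  case (CInf i \<phi>)
  then show ?case
    by (intro cnv_val_quantifier_match[OF assms(1-3)]) simp_all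
qed

theorem theorem3p22:
  fixes G :: "('a, 'm) monoid_scheme" and H :: "('b, 'n) monoid_scheme"
  assumes "group G" and "group H"
    and "grp_omega_saturated G" and "grp_omega_saturated H"
    and "grp_elem_equiv G H"
  shows "cnv_elem_equiv G H"
  unfolding cnv_elem_equiv_def
proof (intro allI impI)
  fix \<phi> assume "cnv_wf \<phi>"
  let ?P = "{set (zip as bs) | as bs. grp_same_type G H as bs}"
  \<comment> \<open>The empty map belongs to the system, and the zero assignments match along it
    because their supports are empty.\<close>
  have "set (zip [] []) \<in> ?P"
    using grp_same_type_Nil[OF assms(1,2,5)] by blast
  then show "cnv_val G (\<lambda>_ _. 0) \<phi> = cnv_val H (\<lambda>_ _. 0) \<phi>"
    by (rule cnv_val_match[OF assms(1,2) back_forth_same_type[OF assms(3,4)] \<open>cnv_wf \<phi>\<close>])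
      (auto simp: l1_ball_zero l1_match_def)
qed

end
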